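(* Let $v(x)=|x|^{\beta}$, $\omega(x)=|x|^{\gamma}$, and $v_i(x)=|x|^{\beta_i}$, $\omega_i(x)=|x|^{\gamma_i}$ for $i=1,\dots,m$, where $\beta,\gamma,\beta_i,\gamma_i>-n$. Let $1\le q<\infty$ and $1\le q_i<\infty$ with $\sum_{i=1}^m \frac1{q_i}=\frac1q$, and let $\lambda,\lambda_i\in\mathbb{R}$ with $1+\lambda q>0$ and $1+\lambda_i q_i>0$. Suppose $$\sum_{i=1}^m \frac{\beta_i}{q_i}=\frac{\beta}{q},\qquad \sum_{i=1}^m\Big(\frac{n+\beta_i}{n+\beta}\Big)\lambda_i=\lambda,\qquad \sum_{i=1}^m \frac{\gamma_i}{q_i}=\frac{\gamma}{q}.$$ Let $\Phi$ and $A_1,\dots,A_m$ be as in the context; in particular $$\rho_{\vec A}:=\operatorname*{ess\,sup}_{t\in\mathbb{R}^n,\ i=1,\dots,m}\|A_i(t)\|\,\|A_i^{-1}(t)\|<\infty .$$ Put $$\mathcal{C}_{1}=\int_{\mathbb{R}^n}\frac{|\Phi(y)|}{|y|^n}\prod_{i=1}^m\|A^{-1}_i(y)\|^{-(\beta_i+n)\lambda_i+(\gamma_i-\beta_i)\frac{1}{q_i}}\, dy .$$ (i) If $\mathcal{C}_1<\infty$, then $\mathcal{H}_{\Phi,\vec{A}}$ is bounded from $\prod_{i=1}^m\dot{M}^{q_i,\lambda_i}_{v_i,\omega_i}(\mathbb{R}^n)$ to $\dot{M}^{q,\lambda}_{v,\omega}(\mathbb{R}^n)$, and $$\|\mathcal{H}_{\Phi,\vec{A}}\|_{\prod_{i=1}^m\dot{M}^{q_i,\lambda_i}_{v_i,\omega_i}(\mathbb{R}^n)\to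 \dot{M}^{q,\lambda}_{v,\omega}(\mathbb{R}^n)}\lesssim \mathcal{C}_{1}.$$ (ii) Conversely, suppose $\Phi$ is a real function with a constant sign in $\mathbb{R}^n$. If $\mathcal{H}_{\Phi,\vec{A}}$ is bounded from $\prod_{i=1}^m\dot{M}^{q_i,\lambda_i}_{v_i,\omega_i}(\mathbb{R}^n)$ to $\dot{M}^{q,\lambda}_{v,\omega}(\mathbb{R}^n)$, then $\mathcal{C}_1<\infty$, and $$\|\mathcal{H}_{\Phi,\vec{A}}\|_{\prod_{i=1}^m\dot{M}^{q_i,\lambda_i}_{v_i,\omega_i}(\mathbb{R}^n)\to \dot{M}^{q,\lambda}_{v,\omega}(\mathbb{R}^n)}\gtrsim \mathcal{C}_{1}.$$
   Context: $n,m\ge 1$ are integers. $\Phi$ is a locally integrable function on $\mathbb{R}^n$; $A_1,\dots,A_m$ are measurable functions on $\mathbb{R}^n$ with values in the $n\times n$ real matrices, invertible almost everywhere. For a matrix $A=(a_{ij})$, $\|A\|=\big(\sum_{i,j=1}^n|a_{ij}|^2\big)^{1/2}$, and $A_i^{-1}(y)$ denotes the inverse of $A_i(y)$. The multilinear Hausdorff operator is, for $\vec f=(f_1,\dots,f_m)$ with $f_i$ complex-valued measurable functions on $\mathbb{R}^n$, $$\mathcal{H}_{\Phi,\vec{A}}(\vec{f})(x)=\int_{\mathbb{R}^n}\frac{\Phi(y)}{|y|^n}\prod_{i=1}^m f_i(A_i(y)x)\,dy,\qquad x\in\mathbb{R}^n.$$ Two weighted central Morrey space: for weights (nonnegative locally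 integrable functions) $v,\omega$ on $\mathbb{R}^n$, $0<q<\infty$ and $\lambda\in\mathbb{R}$ with $1+\lambda q>0$, $\dot{M}^{q,\lambda}_{v,\omega}(\mathbb{R}^n)$ is the set of measurable $f$ with $\int_K|f|^q\omega\,dx<\infty$ for all compact $K\subset\mathbb{R}^n$ and $$\|f\|_{\dot{M}^{q,\lambda}_{v,\omega}(\mathbb{R}^n)}=\sup_{R>0}\frac{1}{v(B(0,R))^{\lambda+\frac1q}}\Big(\int_{B(0,R)}|f(x)|^q\omega(x)\,dx\Big)^{1/q}<\infty,$$ where $B(0,R)$ is the ball centered at $0$ of radius $R$ and $v(E)=\int_E v(x)\,dx$. Boundedness of an $m$-linear operator $T$ from $\prod X_i$ to $Y$ means $\|T(\vec f)\|_Y\le C\prod_i\|f_i\|_{X_i}$ for all $f_i\in X_i$, with $T(\vec f)$ well defined almost everywhere; the operator norm is the least such $C$. $a\lesssim b$ (equivalently $b\gtrsim a$) means $a\le Cb$ with $C>0$ independent of $\vec f$ and $\Phi$; $C$ may depend on $n$, $m$, the exponents and $\rho_{\vec A}$. *)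

theory Defs
  imports "HOL-Analysis.Analysis" "HOL-Probability.Essential_Supremum"
begin

text \<open>The library norm on \<^typ>\<open>real^'n^'n\<close> is the Frobenius norm.\<close>

lemma norm_matrix_eq_frobenius:
  fixes M :: "real^'n^'n"
  shows "norm M = sqrt (\<Sum>i\<in>UNIV. \<Sum>j\<in>UNIV. \<bar>M $ i $ j\<bar>\<^sup>2)"
  by (simp add: norm_vec_def L2_set_def sum_nonneg)

definition locally_integrable :: "('a::euclidean_space \<Rightarrow> 'b::{banach, second_countable_topology}) \<Rightarrow> bool"
  where "locally_integrable f \<longleftrightarrow> (\<forall>K. compact K \<longrightarrow> set_integrable lebesgue K f)"

definition power_weight :: "real \<Rightarrow> 'a::euclidean_space \<Rightarrow> real"
  where "power_weight a x = norm x powr a"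

definition weight_mass :: "('a::euclidean_space \<Rightarrow> real) \<Rightarrow> 'a set \<Rightarrow> real"
  where "weight_mass v E = (LINT x:E|lebesgue. v x)"

definition morrey_quotient ::
    "('a::euclidean_space \<Rightarrow> real) \<Rightarrow> ('a \<Rightarrow> real) \<Rightarrow> real \<Rightarrow> real \<Rightarrow> ('a \<Rightarrow> complex) \<Rightarrow> real \<Rightarrow> real"
  where "morrey_quotient v w q l f R =
    1 / weight_mass v (ball 0 R) powr (l + 1 / q) *
    (LINT x:ball 0 R|lebesgue. norm (f x) powr q * w x) powr (1 / q)"

text \<open>The supremum is a real one; its finiteness is the boundedness condition in
  \<open>morrey_space\<close> below, so \<open>morrey_norm\<close> is meaningful on \<open>morrey_space\<close> only.\<close>

definition morrey_norm ::
    "('a::euclidean_space \<Rightarrow> real) \<Rightarrow> ('a \<Rightarrow> real) \<Rightarrow> real \<Rightarrow> real \<Rightarrow> ('a \<Rightarrow> complex) \<Rightarrow> real"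
  where "morrey_norm v w q l f = (SUP R\<in>{0<..}. morrey_quotient v w q l f R)"

definition morrey_space ::
    "('a::euclidean_space \<Rightarrow> real) \<Rightarrow> ('a \<Rightarrow> real) \<Rightarrow> real \<Rightarrow> real \<Rightarrow> ('a \<Rightarrow> complex) set"
  where "morrey_space v w q l = {f. f \<in> borel_measurable lebesgue \<and>
    (\<forall>K. compact K \<longrightarrow> set_integrable lebesgue K (\<lambda>x. norm (f x) powr q * w x)) \<and>
    bdd_above (morrey_quotient v w q l f ` {0<..})}"

definition hausdorff_integrand ::
    "(real^'n \<Rightarrow> complex) \<Rightarrow> ('m::finite \<Rightarrow> real^'n \<Rightarrow> real^'n^'n) \<Rightarrow>
     ('m \<Rightarrow> real^'n \<Rightarrow> complex) \<Rightarrow> real^'n \<Rightarrow> real^'n \<Rightarrow> complex"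
  where "hausdorff_integrand \<Phi> A f x y =
    \<Phi> y / complex_of_real (norm y ^ CARD('n)) * (\<Prod>i\<in>UNIV. f i (A i y *v x))"

definition hausdorff_op ::
    "(real^'n \<Rightarrow> complex) \<Rightarrow> ('m::finite \<Rightarrow> real^'n \<Rightarrow> real^'n^'n) \<Rightarrow>
     ('m \<Rightarrow> real^'n \<Rightarrow> complex) \<Rightarrow> real^'n \<Rightarrow> complex"
  where "hausdorff_op \<Phi> A f x = (LINT y|lebesgue. hausdorff_integrand \<Phi> A f x y)"

text \<open>The Bochner integral of a non-integrable function is \<open>0\<close>, so convergence of the integral
  defining the operator has to be stated separately.\<close>

definition hausdorff_well_defined ::
    "(real^'n \<Rightarrow> complex) \<Rightarrow> ('m::finite \<Rightarrow> real^'n \<Rightarrow> real^'n^'n) \<Rightarrow>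
     ('m \<Rightarrow> real^'n \<Rightarrow> complex) \<Rightarrow> bool"
  where "hausdorff_well_defined \<Phi> A f \<longleftrightarrow>
    (AE x in lebesgue. integrable lebesgue (hausdorff_integrand \<Phi> A f x))"

text \<open>The admissible constants in \<open>\<parallel>T f\<parallel> \<le> C \<Prod> \<parallel>f\<^sub>i\<parallel>\<close>, for an operator \<open>T\<close> that makes sense
  on the tuples satisfying \<open>D\<close>.\<close>

definition multilinear_bounds ::
    "(('m::finite \<Rightarrow> 'f) \<Rightarrow> bool) \<Rightarrow> (('m \<Rightarrow> 'f) \<Rightarrow> 'g) \<Rightarrow> ('m \<Rightarrow> 'f set) \<Rightarrow> ('m \<Rightarrow> 'f \<Rightarrow> real) \<Rightarrow>
     'g set \<Rightarrow> ('g \<Rightarrow> real) \<Rightarrow> real set"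
  where "multilinear_bounds D T X NX Y NY = {C. 0 \<le> C \<and>
    (\<forall>f. (\<forall>i. f i \<in> X i) \<longrightarrow> D f \<and> T f \<in> Y \<and> NY (T f) \<le> C * (\<Prod>i\<in>UNIV. NX i (f i)))}"

definition hausdorff_bounds where
  "hausdorff_bounds \<Phi> A v w q l vs ws qs ls =
    multilinear_bounds (hausdorff_well_defined \<Phi> A) (hausdorff_op \<Phi> A)
      (\<lambda>i. morrey_space (vs i) (ws i) (qs i) (ls i)) (\<lambda>i. morrey_norm (vs i) (ws i) (qs i) (ls i))
      (morrey_space v w q l) (morrey_norm v w q l)"

definition hausdorff_bounded where
  "hausdorff_bounded \<Phi> A v w q l vs ws qs ls \<longleftrightarrow>
    hausdorff_bounds \<Phi> A v w q l vs ws qs ls \<noteq> {}"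

definition hausdorff_norm where
  "hausdorff_norm \<Phi> A v w q l vs ws qs ls = Inf (hausdorff_bounds \<Phi> A v w q l vs ws qs ls)"

definition admissible_kernel ::
    "(real^'n \<Rightarrow> complex) \<Rightarrow> ('m::finite \<Rightarrow> real^'n \<Rightarrow> real^'n^'n) \<Rightarrow> bool"
  where "admissible_kernel \<Phi> A \<longleftrightarrow> locally_integrable \<Phi> \<and>
    (\<forall>i. A i \<in> borel_measurable lebesgue \<and> (AE y in lebesgue. invertible (A i y)))"

text \<open>At the null set of points where \<open>A i t\<close> is singular, \<^const>\<open>matrix_inv\<close> is unspecified;
  this affects neither of the following two quantities. The essential supremum over pairs \<open>(t, i)\<close>
  is that over \<open>t\<close> of the maximum over the finitely many \<open>i\<close>.\<close>

definition rho :: "('m::finite \<Rightarrow> real^'n \<Rightarrow> real^'n^'n) \<Rightarrow> ereal"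
  where "rho A = esssup lebesgue
    (\<lambda>t. SUP i. ereal (norm (A i t) * norm (matrix_inv (A i t))))"

definition C1 ::
    "(real^'n \<Rightarrow> complex) \<Rightarrow> ('m::finite \<Rightarrow> real^'n \<Rightarrow> real^'n^'n) \<Rightarrow>
     ('m \<Rightarrow> real) \<Rightarrow> ('m \<Rightarrow> real) \<Rightarrow> ('m \<Rightarrow> real) \<Rightarrow> ('m \<Rightarrow> real) \<Rightarrow> ennreal"
  where "C1 \<Phi> A \<beta>s \<gamma>s qs ls = (\<integral>\<^sup>+ y. ennreal (norm (\<Phi> y) / norm y ^ CARD('n) *
    (\<Prod>i\<in>UNIV. norm (matrix_inv (A i y)) powr
      (- (\<beta>s i + real CARD('n)) * ls i + (\<gamma>s i - \<beta>s i) * (1 / qs i)))) \<partial>lebesgue)"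

definition real_of_constant_sign :: "('a \<Rightarrow> complex) \<Rightarrow> bool"
  where "real_of_constant_sign \<Phi> \<longleftrightarrow>
    (\<forall>y. \<Phi> y \<in> \<real>) \<and> ((\<forall>y. 0 \<le> Re (\<Phi> y)) \<or> (\<forall>y. Re (\<Phi> y) \<le> 0))"

end

theory Submission
  imports Defs "HOL-Analysis.Ball_Volume"
begin

text \<open>Since \<open>\<rho>\<close> bounds \<open>\<parallel>A\<^sub>i\<parallel> \<parallel>A\<^sub>i\<inverse>\<parallel>\<close>, each \<open>A\<^sub>i(y)\<close> distorts norms by \<open>\<parallel>A\<^sub>i(y)\<parallel>\<close> up to the factor
  \<open>\<rho>\<close>. Substituting and applying Hoelder's inequality for fixed \<open>y\<close> bounds the weighted norm of
  \<open>\<Prod> f\<^sub>i(A\<^sub>i(y)x)\<close> over a ball by \<open>\<Prod> \<parallel>A\<^sub>i(y)\<parallel> powr s\<^sub>i \<parallel>f\<^sub>i\<parallel>\<close>, where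
  \<open>s\<^sub>i = (\<beta>\<^sub>i + n) \<lambda>\<^sub>i + (\<beta>\<^sub>i - \<gamma>\<^sub>i) / q\<^sub>i\<close>; Minkowski's integral inequality then gives the upper bound.
  The lower bound is tested on \<open>f\<^sub>i(x) = |x| powr s\<^sub>i\<close>, which the operator maps to a function
  comparable to \<open>C\<^sub>1 |x| powr (\<Sum> s\<^sub>i)\<close>.\<close>

subsection \<open>Power weights and linear substitutions\<close>

text \<open>The exponent \<open>s i\<close> is the degree for which the Morrey quotient of
  \<open>norm x powr s i\<close> is the same at every radius, and \<open>- s i\<close> is the
  exponent of the i-th factor of \<open>C1\<close>. The summation hypotheses make the sum of the
  \<open>s i\<close> the corresponding degree of the target space, so powers of R and of
  \<open>norm (A i y)\<close> cancel. What is left depends on \<open>\<rho>\<close>, the exponents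
  and masses of unit balls, and can be fixed before \<open>\<Phi>\<close> and \<open>A\<close>.
  Substitutions produce powers of \<open>norm (A i y)\<close> while \<open>C1\<close> carries powers
  of the norm of the inverse; the bound \<open>\<rho>\<close> makes the two interchangeable. The
  obstacle is measurability. The data are only Lebesgue measurable, so
  \<open>f i (A i y *v x)\<close> need not be Borel in the pair (x, y), as Tonelli's theorem for the
  product of Borel measures requires. The estimates are made for Borel representatives and carried
  back once the two integrands are known to agree for almost every y, for almost every x. Real
  integrals default to 0 when they diverge, so finiteness is always tracked through nonnegative
  extended integrals.\<close>

lemma measurable_ball [measurable]: "ball (c::'a::euclidean_space) r \<in> sets borel"
  by simp

lemma nn_integral_lborel_scaleR:
  fixes f :: "'a::euclidean_space \<Rightarrow> ennreal"
  assumes [measurable]: "f \<in> borel_measurable borel" and "c > 0"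
  shows "(\<integral>\<^sup>+x. f x \<partial>lborel) = ennreal (c ^ DIM('a)) * (\<integral>\<^sup>+x. f (c *\<^sub>R x) \<partial>lborel)"
  using assms(2)
  by (subst lborel_affine[of c 0]) (simp_all add: nn_integral_density nn_integral_distr nn_integral_cmult)

lemma nn_integral_power_weight_scale:
  fixes S :: "'a::euclidean_space set"
  assumes [measurable]: "S \<in> sets borel" and c: "c > 0"
  shows "(\<integral>\<^sup>+x\<in>(*\<^sub>R) c ` S. ennreal (norm x powr a) \<partial>lborel) =
         ennreal (c powr (a + DIM('a))) * (\<integral>\<^sup>+x\<in>S. ennreal (norm x powr a) \<partial>lborel)"
proof -
  have img: "(*\<^sub>R) c ` S = (\<lambda>x. inverse c *\<^sub>R x) -` S \<inter> space borel"
    using c by (auto simp: image_iff intro!: bexI[of _ "inverse c *\<^sub>R _"])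
  have [measurable]: "(*\<^sub>R) c ` S \<in> sets borel"
    unfolding img by measurable
  have mem: "c *\<^sub>R x \<in> (*\<^sub>R) c ` S \<longleftrightarrow> x \<in> S" for x
    using c by auto
  have "(\<integral>\<^sup>+x\<in>(*\<^sub>R) c ` S. ennreal (norm x powr a) \<partial>lborel) =
      ennreal (c ^ DIM('a)) * (\<integral>\<^sup>+x. ennreal (c powr a) * (ennreal (norm x powr a) * indicator S x) \<partial>lborel)"
    using c by (subst nn_integral_lborel_scaleR[OF _ c])
      (auto simp: mem powr_mult ennreal_mult' mult.assoc indicator_def
        intro!: arg_cong2[where f="(*)"] nn_integral_cong)
  also have "\<dots> = ennreal (c powr (a + DIM('a))) * (\<integral>\<^sup>+x\<in>S. ennreal (norm x powr a) \<partial>lborel)"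
    using c by (subst nn_integral_cmult)
      (auto simp: powr_add powr_realpow ennreal_mult' mult_ac)
  finally show ?thesis .
qed

lemma nn_integral_power_weight_ball:
  assumes "r > 0"
  shows "(\<integral>\<^sup>+x\<in>ball (0::'a::euclidean_space) r. ennreal (norm x powr a) \<partial>lborel) =
         ennreal (r powr (a + DIM('a))) * (\<integral>\<^sup>+x\<in>ball (0::'a) 1. ennreal (norm x powr a) \<partial>lborel)"
proof -
  have "ball (0::'a) r = (*\<^sub>R) r ` ball 0 1"
    using assms by (auto simp: image_iff field_simps intro!: bexI[of _ "inverse r *\<^sub>R _"])
  then show ?thesis
    using nn_integral_power_weight_scale[of "ball (0::'a) 1" r a] assms by simp
qed

text \<open>All pieces are rescalings of one shell that stays away from the origin, so homogeneity
  of a power weight turns its integral over the ball into a geometric series.\<close>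

lemma unit_ball_dyadic_shells:
  "ball (0::'a::real_normed_vector) 1 - {0} = (\<Union>k. (*\<^sub>R) ((1/2) ^ k) ` (ball 0 1 - ball 0 (1/2)))"
proof (intro equalityI subsetI)
  fix x :: 'a assume x: "x \<in> ball 0 1 - {0}"
  \<comment> \<open>That k qualifies gives the lower bound on the norm, its minimality the strict
    upper bound; for k = 0 the latter is \<open>norm x < 1\<close>.\<close>
  define k where "k = (LEAST k. (1/2) ^ Suc k \<le> norm x)"
  have "\<exists>k. (1/2::real) ^ k < norm x"
    using x real_arch_pow_inv[of "norm x" "1/2"] by auto
  then obtain j :: nat where "(1/2) ^ j < norm x" by auto
  then have "(1/2::real) ^ Suc j \<le> norm x"
    by (simp add: field_simps)
  then have k1: "(1/2) ^ Suc k \<le> norm x"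
    unfolding k_def by (rule LeastI)
  have k2: "norm x < (1/2) ^ k"
  proof (cases k)
    case 0
    then show ?thesis using x by simp
  next
    case (Suc i)
    then show ?thesis
      using not_less_Least[of i "\<lambda>k. (1/2) ^ Suc k \<le> norm x"] by (simp add: k_def not_le)
  qed
  have "(2 ^ k) *\<^sub>R x \<in> ball 0 1 - ball 0 (1/2)"
    using k1 k2 by (simp add: field_simps power_one_over)
  moreover have "x = (1/2) ^ k *\<^sub>R ((2 ^ k) *\<^sub>R x)"
    by (simp add: power_one_over)
  ultimately show "x \<in> (\<Union>k. (*\<^sub>R) ((1/2) ^ k) ` (ball 0 1 - ball 0 (1/2)))"
    by blast
next
  fix x :: 'a assume "x \<in> (\<Union>k. (*\<^sub>R) ((1/2) ^ k) ` (ball 0 1 - ball 0 (1/2)))"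
  then obtain k y where x: "x = (1/2) ^ k *\<^sub>R y" and y: "norm y < 1" "1/2 \<le> norm y"
    by auto
  have "norm x \<le> 1 * norm y"
    unfolding x norm_scaleR by (intro mult_right_mono) (auto simp: power_le_one)
  with x y show "x \<in> ball 0 1 - {0}" by auto
qed

text \<open>By homogeneity the k-th dyadic shell contributes \<open>\<theta> ^ k\<close> times the
  outermost one, and \<open>\<theta> < 1\<close> because a + DIM is positive.\<close>

lemma nn_integral_power_weight_finite:
  assumes "a > - real DIM('a::euclidean_space)"
  shows "(\<integral>\<^sup>+x\<in>ball (0::'a) 1. ennreal (norm x powr a) \<partial>lborel) < \<infinity>"
proof -
  define E where "E = ball (0::'a) 1 - ball 0 (1/2)"
  define \<theta> where "\<theta> = (1/2) powr (a + DIM('a))"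
  have E[measurable]: "E \<in> sets borel" unfolding E_def by measurable
  have \<theta>: "0 < \<theta>" "\<theta> < 1"
    using assms powr_less_mono2[of "a + DIM('a)" "1/2" 1] by (auto simp: \<theta>_def)
  define I where "I = (\<integral>\<^sup>+x\<in>E. ennreal (norm x powr a) \<partial>lborel)"
  \<comment> \<open>On the shell the weight is at most 1 for a \<ge> 0 and at most its value at
    radius 1/2 for a < 0; the maximum covers both signs.\<close>
  have "I \<le> (\<integral>\<^sup>+x. ennreal (max 1 (2 powr - a)) * indicator (ball (0::'a) 1) x \<partial>lborel)"
    unfolding I_def
  proof (rule nn_integral_mono, goal_cases)
    case (1 x)
    show ?case
    proof (cases "x \<in> E")
      case True
      then have x: "1/2 \<le> norm x" "norm x \<le> 1" by (auto simp: E_def)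
      have "norm x powr a \<le> max 1 (2 powr - a)"
      proof (cases "a \<ge> 0")
        case True
        then show ?thesis using x powr_mono2[of a "norm x" 1] by auto
      next
        case False
        then have "norm x powr a \<le> (1/2) powr a"
          using x by (intro powr_mono2') auto
        also have "(1/2) powr a = 2 powr - a"
          by (simp add: powr_divide powr_minus field_simps)
        finally show ?thesis by auto
      qed
      then show ?thesis using True by (auto simp: E_def ennreal_leI)
    qed auto
  qed
  also have "\<dots> < \<infinity>"
    using emeasure_lborel_ball_finite[of "0::'a" 1]
    by (subst nn_integral_cmult_indicator) (auto simp: ennreal_mult_less_top)
  finally have I: "I < \<infinity>" .
  define J where "J k = (\<integral>\<^sup>+x\<in>(*\<^sub>R) ((1/2) ^ k) ` E. ennreal (norm x powr a) \<partial>lborel)" for k :: nat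
  have J: "J k = ennreal (\<theta> ^ k) * I" for k
  proof -
    have "((1/2::real) ^ k) powr (a + DIM('a)) = \<theta> ^ k"
      by (simp add: \<theta>_def powr_realpow[symmetric] powr_powr mult.commute)
    then show ?thesis
      unfolding J_def I_def by (subst nn_integral_power_weight_scale) auto
  qed
  have meas: "(*\<^sub>R) ((1/2) ^ k) ` E \<in> sets borel" for k :: nat
  proof -
    have "(*\<^sub>R) ((1/2) ^ k) ` E = (\<lambda>x. (2 ^ k) *\<^sub>R x) -` E \<inter> space borel"
      by (auto simp: image_iff power_one_over intro!: bexI[of _ "(2^k) *\<^sub>R _"])
    also have "\<dots> \<in> sets borel" by measurable
    finally show ?thesis .
  qed
  have "(\<integral>\<^sup>+x\<in>ball (0::'a) 1. ennreal (norm x powr a) \<partial>lborel) \<le>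
      (\<integral>\<^sup>+x. (\<Sum>k. ennreal (norm x powr a) * indicator ((*\<^sub>R) ((1/2) ^ k) ` E) x) \<partial>lborel)"
  proof (rule nn_integral_mono, goal_cases)
    case (1 x)
    \<comment> \<open>The origin lies in no shell, but \<open>0 powr a = 0\<close> makes its
      contribution vanish.\<close>
    show ?case
    proof (cases "x \<in> ball 0 1 \<and> x \<noteq> 0")
      case True
      then obtain k where "x \<in> (*\<^sub>R) ((1/2) ^ k) ` E"
        using unit_ball_dyadic_shells unfolding E_def by blast
      then have "ennreal (norm x powr a) * indicator (ball 0 1) x =
          (\<Sum>i\<in>{k}. ennreal (norm x powr a) * indicator ((*\<^sub>R) ((1/2) ^ i) ` E) x)"
        using True by simp
      also have "\<dots> \<le> (\<Sum>k. ennreal (norm x powr a) * indicator ((*\<^sub>R) ((1/2) ^ k) ` E) x)"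
        by (intro sum_le_suminf) auto
      finally show ?thesis .
    qed auto
  qed
  also have "\<dots> = (\<Sum>k. J k)"
    unfolding J_def using meas by (intro nn_integral_suminf) auto
  also have "\<dots> = (\<Sum>k. ennreal (\<theta> ^ k)) * I"
    by (simp add: J ennreal_suminf_multc)
  also have "(\<Sum>k. ennreal (\<theta> ^ k)) = ennreal (\<Sum>k. \<theta> ^ k)"
    using \<theta> by (intro suminf_ennreal2) (auto intro!: summable_geometric)
  also have "\<dots> * I < \<infinity>"
    using I by (simp add: ennreal_mult_less_top)
  finally show ?thesis .
qed

text \<open>Averaging \<open>\<integral> u (T x) dx\<close> over translations by \<open>y \<in> ball 0 1\<close> and exchanging the integrals
  bounds the Jacobian factor without determinants.\<close>

lemma nn_integral_linear_comp_le:
  fixes T :: "'a::euclidean_space \<Rightarrow> 'a"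
  assumes u[measurable]: "u \<in> borel_measurable borel"
    and T: "linear T" and m: "m > 0" and exp: "\<And>x. m * norm x \<le> norm (T x)"
  shows "(\<integral>\<^sup>+x. u (T x) \<partial>lborel) \<le> ennreal ((1 / m) ^ DIM('a)) * (\<integral>\<^sup>+x. u x \<partial>lborel)"
proof -
  define B where "B = ball (0::'a) 1"
  have [measurable]: "B \<in> sets borel" by (simp add: B_def)
  have [measurable]: "T \<in> borel_measurable borel"
    using T by (intro borel_measurable_continuous_onI linear_continuous_on) (simp add: linear_conv_bounded_linear)
  have "inj T"
  proof (rule injI)
    fix x y assume "T x = T y"
    then have "T (x - y) = 0" using T by (simp add: linear_diff)
    then have "m * norm (x - y) \<le> 0" using exp[of "x - y"] by simp
    then show "x = y" using m by (simp add: mult_le_0_iff)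
  qed
  then have surj: "surj T" by (rule linear_inj_imp_surj[OF T])
  have transl: "(\<integral>\<^sup>+x. g (x + c) \<partial>lborel) = (\<integral>\<^sup>+x. g x \<partial>lborel)"
    if [measurable]: "g \<in> borel_measurable borel" for g :: "'a \<Rightarrow> ennreal" and c
    by (subst (2) lborel_distr_plus[of c, symmetric]) (simp add: nn_integral_distr add.commute)
  have "(\<integral>\<^sup>+x. u (T x) \<partial>lborel) * emeasure lborel B = (\<integral>\<^sup>+y. (\<integral>\<^sup>+x. u (T x) \<partial>lborel) * indicator B y \<partial>lborel)"
    by (subst nn_integral_cmult_indicator) auto
  also have "\<dots> = (\<integral>\<^sup>+y. (\<integral>\<^sup>+x. u (T x + y) * indicator B y \<partial>lborel) \<partial>lborel)"
  proof (rule nn_integral_cong, goal_cases)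
    case (1 y)
    obtain c where c: "y = T c" using surj by (metis surj_def)
    have "(\<integral>\<^sup>+x. u (T x) \<partial>lborel) = (\<integral>\<^sup>+x. u (T (x + c)) \<partial>lborel)"
      by (subst transl[of "\<lambda>x. u (T x)" c]) auto
    also have "\<dots> = (\<integral>\<^sup>+x. u (T x + y) \<partial>lborel)"
      using T by (simp add: linear_add c)
    finally show ?case
      by (simp add: nn_integral_multc)
  qed
  also have "\<dots> = (\<integral>\<^sup>+x. (\<integral>\<^sup>+y. u (T x + y) * indicator B y \<partial>lborel) \<partial>lborel)"
    by (rule lborel_pair.Fubini') measurable
  also have "\<dots> = (\<integral>\<^sup>+x. (\<integral>\<^sup>+z. u z * indicator B (z - T x) \<partial>lborel) \<partial>lborel)"
  proof (rule nn_integral_cong, goal_cases)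
    case (1 x)
    show ?case
      using transl[of "\<lambda>z. u z * indicator B (z - T x)" "T x"] by (simp add: add.commute)
  qed
  also have "\<dots> = (\<integral>\<^sup>+z. (\<integral>\<^sup>+x. u z * indicator B (z - T x) \<partial>lborel) \<partial>lborel)"
    by (rule lborel_pair.Fubini'[symmetric]) measurable
  also have "\<dots> \<le> (\<integral>\<^sup>+z. u z * (ennreal ((1 / m) ^ DIM('a)) * emeasure lborel B) \<partial>lborel)"
  proof (rule nn_integral_mono, goal_cases)
    case (1 z)
    \<comment> \<open>The centre is pulled back through T: if T x is within distance 1 of T c,
      expansion puts x within 1/m of c, and the volume of that ball supplies the factor
      (1/m)^DIM.\<close>
    obtain c where c: "z = T c" using surj by (metis surj_def)
    have "(\<integral>\<^sup>+x. u z * indicator B (z - T x) \<partial>lborel) \<le> (\<integral>\<^sup>+x. u z * indicator (ball c (1/m)) x \<partial>lborel)"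
    proof (intro nn_integral_mono mult_left_mono, goal_cases)
      case (1 x)
      show ?case
      proof (cases "z - T x \<in> B")
        case True
        then have "norm (T (c - x)) < 1" using T by (simp add: B_def c linear_diff)
        then have "m * norm (c - x) < 1" using exp[of "c - x"] by simp
        then have "x \<in> ball c (1/m)" using m by (simp add: dist_norm field_simps)
        then show ?thesis by (simp add: indicator_def)
      qed simp
    qed simp
    also have "\<dots> = u z * emeasure lborel (ball c (1/m))"
      by (simp add: nn_integral_cmult_indicator)
    also have "emeasure lborel (ball c (1/m)) = ennreal ((1 / m) ^ DIM('a)) * emeasure lborel B"
      using m by (simp add: B_def emeasure_ball ennreal_mult' mult.commute)
    finally show ?case .
  qed
  also have "\<dots> = (ennreal ((1 / m) ^ DIM('a)) * (\<integral>\<^sup>+z. u z \<partial>lborel)) * emeasure lborel B"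
    by (simp add: nn_integral_multc mult_ac)
  finally have "(\<integral>\<^sup>+x. u (T x) \<partial>lborel) * emeasure lborel B \<le> \<dots>" .
  moreover have "emeasure lborel B \<noteq> 0" "emeasure lborel B \<noteq> \<infinity>"
    using content_ball_gt_0_iff[of "0::'a" 1] emeasure_lborel_ball_finite[of "0::'a" 1] unfolding B_def
    by (auto simp: measure_def)
  ultimately show ?thesis
    by (auto simp: ennreal_mult_le_mult_iff mult.commute[of _ "emeasure lborel B"])
qed

subsection \<open>Integral inequalities\<close>

text \<open>Concavity of \<open>ln\<close>, exponentiated. A vanishing factor is set apart because
  the logarithm says nothing there; it makes the whole product 0.\<close>

lemma weighted_geometric_mean_le:
  fixes \<theta> a :: "'i \<Rightarrow> real"
  assumes I: "finite I" and \<theta>: "\<And>i. i \<in> I \<Longrightarrow> \<theta> i > 0" "(\<Sum>i\<in>I. \<theta> i) = 1"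
    and a: "\<And>i. i \<in> I \<Longrightarrow> a i \<ge> 0"
  shows "(\<Prod>i\<in>I. a i powr \<theta> i) \<le> (\<Sum>i\<in>I. \<theta> i * a i)"
proof (cases "\<exists>i\<in>I. a i = 0")
  case True
  then have "(\<Prod>i\<in>I. a i powr \<theta> i) = 0" using I by (auto simp: prod_zero_iff)
  moreover have "0 \<le> (\<Sum>i\<in>I. \<theta> i * a i)"
    using \<theta> a by (intro sum_nonneg mult_nonneg_nonneg) (auto simp: less_imp_le)
  ultimately show ?thesis by simp
next
  case False
  then have a: "\<And>i. i \<in> I \<Longrightarrow> a i > 0" using a by (auto simp: less_le)
  have "I \<noteq> {}" using \<theta> by auto
  then have pos: "0 < (\<Sum>i\<in>I. \<theta> i * a i)"
    using I \<theta> a by (intro sum_pos) auto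
  have "(\<Sum>i\<in>I. \<theta> i * ln (a i)) \<le> ln (\<Sum>i\<in>I. \<theta> i *\<^sub>R a i)"
    using concave_on_sum[OF I \<open>I \<noteq> {}\<close> ln_concave, of \<theta> a] \<theta> a by (auto intro: less_imp_le)
  then have "exp (\<Sum>i\<in>I. \<theta> i * ln (a i)) \<le> (\<Sum>i\<in>I. \<theta> i * a i)"
    using pos by (simp add: ln_ge_iff)
  also have "exp (\<Sum>i\<in>I. \<theta> i * ln (a i)) = (\<Prod>i\<in>I. a i powr \<theta> i)"
  proof -
    have "a i \<noteq> 0" if "i \<in> I" for i using a[OF that] by simp
    then show ?thesis using I by (auto simp: exp_sum powr_def intro!: prod.cong)
  qed
  finally show ?thesis .
qed

text \<open>The functions enter already raised to their powers, so the exponents are weights with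
  sum 1. After division by its own bound, each function contributes at most
  \<open>\<theta> i\<close> to the integrated inequality of means.\<close>

lemma nn_integral_Holder:
  fixes a :: "'i \<Rightarrow> 'a \<Rightarrow> real"
  assumes I: "finite I" and \<theta>: "\<And>i. i \<in> I \<Longrightarrow> \<theta> i > 0" "(\<Sum>i\<in>I. \<theta> i) = 1"
    and [measurable]: "\<And>i. i \<in> I \<Longrightarrow> a i \<in> borel_measurable M"
    and a: "\<And>i x. i \<in> I \<Longrightarrow> a i x \<ge> 0"
    and N: "\<And>i. i \<in> I \<Longrightarrow> N i \<ge> 0"
    and le: "\<And>i. i \<in> I \<Longrightarrow> (\<integral>\<^sup>+x. ennreal (a i x) \<partial>M) \<le> ennreal (N i)"
  shows "(\<integral>\<^sup>+x. ennreal (\<Prod>i\<in>I. a i x powr \<theta> i) \<partial>M) \<le> ennreal (\<Prod>i\<in>I. N i powr \<theta> i)"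
proof -
  \<comment> \<open>Enlarging every bound by e > 0 permits the division even if some
    \<open>N i\<close> is 0; e tends to 0 at the end.\<close>
  have eps: "(\<integral>\<^sup>+x. ennreal (\<Prod>i\<in>I. a i x powr \<theta> i) \<partial>M) \<le> ennreal (\<Prod>i\<in>I. (N i + e) powr \<theta> i)"
    if e: "e > 0" for e
  proof -
    define P where "P = (\<Prod>i\<in>I. (N i + e) powr \<theta> i)"
    have P: "P \<ge> 0" unfolding P_def by (intro prod_nonneg) auto
    have Ne: "N i + e > 0" if "i \<in> I" for i using N[OF that] e by simp
    have "(\<integral>\<^sup>+x. ennreal (\<Prod>i\<in>I. a i x powr \<theta> i) \<partial>M) \<le>
        (\<integral>\<^sup>+x. ennreal P * (\<Sum>i\<in>I. ennreal (\<theta> i / (N i + e)) * ennreal (a i x)) \<partial>M)"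
    proof (rule nn_integral_mono, goal_cases)
      case (1 x)
      have "(\<Prod>i\<in>I. a i x powr \<theta> i) = P * (\<Prod>i\<in>I. (a i x / (N i + e)) powr \<theta> i)"
        unfolding P_def prod.distrib[symmetric]
      proof (intro prod.cong refl)
        fix i assume "i \<in> I"
        then show "a i x powr \<theta> i = (N i + e) powr \<theta> i * (a i x / (N i + e)) powr \<theta> i"
          using Ne[of i] a[of i x] by (simp add: powr_divide)
      qed
      also have "\<dots> \<le> P * (\<Sum>i\<in>I. \<theta> i * (a i x / (N i + e)))"
        using P Ne a \<theta> I by (intro mult_left_mono weighted_geometric_mean_le) (auto simp: less_imp_le)
      finally have "ennreal (\<Prod>i\<in>I. a i x powr \<theta> i) \<le> ennreal (P * (\<Sum>i\<in>I. \<theta> i / (N i + e) * a i x))"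
        by (intro ennreal_leI) simp
      also have "\<dots> = ennreal P * (\<Sum>i\<in>I. ennreal (\<theta> i / (N i + e)) * ennreal (a i x))"
      proof -
        have t: "\<theta> i / (N i + e) \<ge> 0" if "i \<in> I" for i
          using \<theta>(1)[OF that] Ne[OF that] by simp
        have "(\<Sum>i\<in>I. ennreal (\<theta> i / (N i + e)) * ennreal (a i x)) = (\<Sum>i\<in>I. ennreal (\<theta> i / (N i + e) * a i x))"
          using t a by (intro sum.cong refl ennreal_mult[symmetric]) auto
        also have "\<dots> = ennreal (\<Sum>i\<in>I. \<theta> i / (N i + e) * a i x)"
          using t a by (intro sum_ennreal mult_nonneg_nonneg) auto
        finally show ?thesis using P by (simp only: ennreal_mult')
      qed
      finally show ?case .
    qed
    also have "\<dots> = ennreal P * (\<Sum>i\<in>I. ennreal (\<theta> i / (N i + e)) * (\<integral>\<^sup>+x. ennreal (a i x) \<partial>M))"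
      by (subst nn_integral_cmult) (auto simp: nn_integral_sum nn_integral_cmult)
    also have "\<dots> \<le> ennreal P * (\<Sum>i\<in>I. ennreal (\<theta> i))"
    proof (intro mult_left_mono sum_mono)
      fix i assume i: "i \<in> I"
      have "ennreal (\<theta> i / (N i + e)) * (\<integral>\<^sup>+x. ennreal (a i x) \<partial>M) \<le> ennreal (\<theta> i / (N i + e)) * ennreal (N i)"
        using le[OF i] by (intro mult_left_mono) auto
      also have "\<dots> = ennreal (\<theta> i * (N i / (N i + e)))"
        using N[OF i] Ne[OF i] \<theta>(1)[OF i] by (simp add: ennreal_mult[symmetric])
      also have "\<dots> \<le> ennreal (\<theta> i)"
        using N[OF i] Ne[OF i] \<theta>(1)[OF i] e by (intro ennreal_leI) (simp add: field_simps)
      finally show "ennreal (\<theta> i / (N i + e)) * (\<integral>\<^sup>+x. ennreal (a i x) \<partial>M) \<le> ennreal (\<theta> i)" .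
    qed auto
    also have "\<dots> = ennreal P"
      using \<theta> by (subst sum_ennreal) (auto simp: less_imp_le)
    finally show ?thesis unfolding P_def .
  qed
  have "(\<lambda>n. ennreal (\<Prod>i\<in>I. (N i + inverse (real (Suc n))) powr \<theta> i))
      \<longlonglongrightarrow> ennreal (\<Prod>i\<in>I. N i powr \<theta> i)"
  proof (intro tendsto_ennrealI tendsto_prod)
    fix i assume i: "i \<in> I"
    have "(\<lambda>n. N i + inverse (real (Suc n))) \<longlonglongrightarrow> N i + 0"
      by (intro tendsto_intros LIMSEQ_inverse_real_of_nat)
    then show "(\<lambda>n. (N i + inverse (real (Suc n))) powr \<theta> i) \<longlonglongrightarrow> N i powr \<theta> i"
      using \<theta>(1)[OF i] N[OF i] by (intro tendsto_powr') auto
  qed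
  then show ?thesis
    by (rule LIMSEQ_le_const) (use eps in auto)
qed

text \<open>Hoelder for \<open>g powr q * k\<close> and \<open>k\<close> with weights 1/q and 1 -
  1/q. Naming the value \<open>h\<close> records finiteness as well, which \<open>enn2real\<close>
  would hide.\<close>

lemma nn_integral_weighted_Jensen:
  fixes g k :: "'a \<Rightarrow> real"
  assumes q: "q \<ge> 1"
    and [measurable]: "g \<in> borel_measurable M" "k \<in> borel_measurable M"
    and g: "\<And>x. g x \<ge> 0" and k: "\<And>x. k x \<ge> 0"
    and m: "m \<ge> 0" "(\<integral>\<^sup>+x. ennreal (k x) \<partial>M) \<le> ennreal m"
    and p: "p \<ge> 0" "(\<integral>\<^sup>+x. ennreal (g x powr q * k x) \<partial>M) \<le> ennreal p"
  shows "\<exists>h\<ge>0. (\<integral>\<^sup>+x. ennreal (g x * k x) \<partial>M) = ennreal h \<and> h powr q \<le> m powr (q - 1) * p"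
proof -
  \<comment> \<open>For q = 1 the second weight would be 0, outside the reach of Hoelder. If
    moreover m = 0, the factor \<open>m powr (q - 1)\<close> is \<open>0 powr 0 = 0\<close>, so the
    integral itself must vanish; it does, as \<open>k\<close> is 0 almost everywhere.\<close>
  define H where "H = (if q = 1 then if m = 0 then 0 else p else p powr (1 / q) * m powr (1 - 1 / q))"
  have H: "H \<ge> 0" using m p by (auto simp: H_def)
  have "(\<integral>\<^sup>+x. ennreal (g x * k x) \<partial>M) \<le> ennreal H"
  proof (cases "q = 1")
    case True
    have "AE x in M. k x \<le> 0" if "m = 0"
    proof -
      have "(\<integral>\<^sup>+x. ennreal (k x) \<partial>M) = 0" using m that by simp
      then show ?thesis by (subst (asm) nn_integral_0_iff_AE) (auto simp: ennreal_eq_0_iff)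
    qed
    then have "AE x in M. g x * k x \<le> 0" if "m = 0"
      using that k by (force intro: mult_nonneg_nonpos g elim: eventually_mono)
    then have "(\<integral>\<^sup>+x. ennreal (g x * k x) \<partial>M) = 0" if "m = 0"
      using that by (subst nn_integral_0_iff_AE) (auto simp: ennreal_eq_0_iff)
    moreover have "(\<integral>\<^sup>+x. ennreal (g x * k x) \<partial>M) \<le> ennreal p"
      using p g True by (simp add: powr_one_gt_zero_iff)
    ultimately show ?thesis using True by (auto simp: H_def)
  next
    case False
    then have q: "q > 1" using q by simp
    \<comment> \<open>The two factors are indexed by the booleans, so that the finite-family
      inequality applies.\<close>
    define a where "a b x = (if b then g x powr q * k x else k x)" for b x
    define \<theta> where "\<theta> b = (if b then 1 / q else 1 - 1 / q)" for b
    have "(\<integral>\<^sup>+x. ennreal (\<Prod>b\<in>UNIV. a b x powr \<theta> b) \<partial>M) \<le> ennreal (\<Prod>b\<in>UNIV. (if b then p else m) powr \<theta> b)"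
    proof (rule nn_integral_Holder)
      show "a b \<in> borel_measurable M" for b unfolding a_def[abs_def] by (cases b) auto
    qed (use q m p g k in \<open>auto simp: a_def \<theta>_def UNIV_bool\<close>)
    also have "(\<lambda>x. ennreal (\<Prod>b\<in>UNIV. a b x powr \<theta> b)) = (\<lambda>x. ennreal (g x * k x))"
    proof
      fix x
      have "(\<Prod>b\<in>UNIV. a b x powr \<theta> b) = (g x powr q * k x) powr (1 / q) * k x powr (1 - 1 / q)"
        by (simp add: UNIV_bool a_def \<theta>_def mult.commute)
      also have "\<dots> = g x * (k x powr (1 / q) * k x powr (1 - 1 / q))"
        using g[of x] k[of x] q by (simp add: powr_mult powr_powr)
      also have "\<dots> = g x * k x"
        using k[of x] q by (subst powr_add[symmetric]) simp
      finally show "ennreal (\<Prod>b\<in>UNIV. a b x powr \<theta> b) = ennreal (g x * k x)" by simp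
    qed
    finally show ?thesis using q by (simp add: H_def UNIV_bool \<theta>_def mult.commute)
  qed
  then obtain h where h: "h \<ge> 0" "(\<integral>\<^sup>+x. ennreal (g x * k x) \<partial>M) = ennreal h" "h \<le> H"
    using H by (cases "\<integral>\<^sup>+x. ennreal (g x * k x) \<partial>M") (auto simp: top_unique)
  have "h powr q \<le> H powr q" using h q by (intro powr_mono2) auto
  also have "H powr q \<le> m powr (q - 1) * p"
  proof (cases "q = 1")
    case True then show ?thesis using m p by (auto simp: H_def)
  next
    case False
    then have "H powr q = p * m powr ((1 - 1 / q) * q)"
      using q p m by (simp add: H_def powr_mult powr_powr)
    also have "(1 - 1 / q) * q = q - 1" using q by (simp add: field_simps)
    finally show ?thesis by simp
  qed
  finally show ?thesis using h by auto
qed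

text \<open>With k as a density of mass at most m, Jensen at fixed x followed by Tonelli gives
  \<open>m powr (q - 1) * m * D\<close>; a bound D uniform in y makes this simple route sharp
  enough. The first conclusion excludes that the second is met merely because
  \<open>enn2real\<close> sends infinity to 0.\<close>

lemma (in pair_sigma_finite) nn_integral_Minkowski:
  fixes G :: "'a \<Rightarrow> 'b \<Rightarrow> real" and w :: "'a \<Rightarrow> real" and k :: "'b \<Rightarrow> real"
  assumes q: "q \<ge> 1"
    and [measurable]: "case_prod G \<in> borel_measurable (M1 \<Otimes>\<^sub>M M2)"
      "w \<in> borel_measurable M1" "k \<in> borel_measurable M2"
    and nonneg: "\<And>x y. G x y \<ge> 0" "\<And>x. w x \<ge> 0" "\<And>y. k y \<ge> 0"
    and m: "m \<ge> 0" "(\<integral>\<^sup>+y. ennreal (k y) \<partial>M2) \<le> ennreal m" and D: "D \<ge> 0"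
    and le: "AE y in M2. (\<integral>\<^sup>+x. ennreal (G x y powr q * w x) \<partial>M1) \<le> ennreal D"
  shows "AE x in M1. w x > 0 \<longrightarrow> (\<integral>\<^sup>+y. ennreal (G x y * k y) \<partial>M2) < \<infinity>"
    and "(\<integral>\<^sup>+x. ennreal (enn2real (\<integral>\<^sup>+y. ennreal (G x y * k y) \<partial>M2) powr q * w x) \<partial>M1)
      \<le> ennreal (m powr q * D)"
proof -
  define P where "P x = (\<integral>\<^sup>+y. ennreal (G x y powr q * k y) \<partial>M2)" for x
  have [measurable]: "P \<in> borel_measurable M1" unfolding P_def[abs_def] by measurable
  have "(\<integral>\<^sup>+x. P x * ennreal (w x) \<partial>M1) = (\<integral>\<^sup>+x. (\<integral>\<^sup>+y. ennreal (G x y powr q * k y) * ennreal (w x) \<partial>M2) \<partial>M1)"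
    unfolding P_def by (intro nn_integral_cong nn_integral_multc[symmetric]) measurable
  also have "\<dots> = (\<integral>\<^sup>+y. (\<integral>\<^sup>+x. ennreal (G x y powr q * k y) * ennreal (w x) \<partial>M1) \<partial>M2)"
    by (rule Fubini'[symmetric]) measurable
  also have "\<dots> = (\<integral>\<^sup>+y. ennreal (k y) * (\<integral>\<^sup>+x. ennreal (G x y powr q * w x) \<partial>M1) \<partial>M2)"
  proof (rule nn_integral_cong, goal_cases)
    case (1 y)
    then have [measurable]: "(\<lambda>x. G x y) \<in> borel_measurable M1" by measurable
    have "(\<integral>\<^sup>+x. ennreal (G x y powr q * k y) * ennreal (w x) \<partial>M1)
        = (\<integral>\<^sup>+x. ennreal (k y) * ennreal (G x y powr q * w x) \<partial>M1)"
      using nonneg by (intro nn_integral_cong) (simp add: ennreal_mult mult_ac)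
    then show ?case by (simp add: nn_integral_cmult)
  qed
  also have "\<dots> \<le> (\<integral>\<^sup>+y. ennreal (k y) * ennreal D \<partial>M2)"
    using le by (intro nn_integral_mono_AE) (auto elim!: eventually_mono intro: mult_left_mono)
  also have "\<dots> = (\<integral>\<^sup>+y. ennreal (k y) \<partial>M2) * ennreal D"
    by (simp add: nn_integral_multc)
  also have "\<dots> \<le> ennreal m * ennreal D"
    using m by (intro mult_right_mono) auto
  finally have PD: "(\<integral>\<^sup>+x. P x * ennreal (w x) \<partial>M1) \<le> ennreal (m * D)"
    using m D by (simp add: ennreal_mult)
  then have "AE x in M1. P x * ennreal (w x) \<noteq> \<infinity>"
    by (intro nn_integral_PInf_AE) (auto simp: top_unique)
  \<comment> \<open>Where w vanishes, the product is 0 even if \<open>P x\<close> is infinite, so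
    finiteness follows only on the set where w is positive.\<close>
  then have fin: "AE x in M1. w x > 0 \<longrightarrow> P x < \<infinity>"
    by eventually_elim (auto simp: ennreal_mult_eq_top_iff less_top)
  have J: "\<exists>h\<ge>0. (\<integral>\<^sup>+y. ennreal (G x y * k y) \<partial>M2) = ennreal h \<and> h powr q \<le> m powr (q - 1) * enn2real (P x)"
    if "P x < \<infinity>" "x \<in> space M1" for x
    using that nonneg m unfolding P_def
    by (intro nn_integral_weighted_Jensen[OF q]) (auto simp: less_top)
  show "AE x in M1. w x > 0 \<longrightarrow> (\<integral>\<^sup>+y. ennreal (G x y * k y) \<partial>M2) < \<infinity>"
    using fin AE_space
  proof eventually_elim
    case (elim x)
    then show ?case using J[of x] by auto
  qed
  have "(\<integral>\<^sup>+x. ennreal (enn2real (\<integral>\<^sup>+y. ennreal (G x y * k y) \<partial>M2) powr q * w x) \<partial>M1)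
      \<le> (\<integral>\<^sup>+x. ennreal (m powr (q - 1)) * (P x * ennreal (w x)) \<partial>M1)"
  proof (rule nn_integral_mono_AE, use fin AE_space in eventually_elim)
    fix x assume x: "0 < w x \<longrightarrow> P x < \<infinity>" "x \<in> space M1"
    show "ennreal (enn2real (\<integral>\<^sup>+y. ennreal (G x y * k y) \<partial>M2) powr q * w x)
      \<le> ennreal (m powr (q - 1)) * (P x * ennreal (w x))"
    proof (cases "w x > 0")
      case True
      then obtain h where h: "h \<ge> 0" "(\<integral>\<^sup>+y. ennreal (G x y * k y) \<partial>M2) = ennreal h"
          "h powr q \<le> m powr (q - 1) * enn2real (P x)"
        using J x by blast
      have "ennreal (h powr q * w x) \<le> ennreal (m powr (q - 1) * enn2real (P x) * w x)"
        using h True by (intro ennreal_leI mult_right_mono) auto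
      also have "\<dots> = ennreal (m powr (q - 1)) * (ennreal (enn2real (P x)) * ennreal (w x))"
        using True by (simp add: ennreal_mult mult.assoc)
      finally show ?thesis using h x True by simp
    qed (use nonneg(2)[of x] in auto)
  qed
  also have "\<dots> = ennreal (m powr (q - 1)) * (\<integral>\<^sup>+x. P x * ennreal (w x) \<partial>M1)"
    by (rule nn_integral_cmult) measurable
  also have "\<dots> \<le> ennreal (m powr (q - 1)) * ennreal (m * D)"
    using PD by (intro mult_left_mono) auto
  also have "\<dots> = ennreal (m powr (q - 1) * m * D)"
    using m D by (simp add: ennreal_mult[symmetric] mult.assoc)
  also have "m powr (q - 1) * m = m powr q"
    using m q by (cases "m = 0") (auto simp: powr_diff)
  finally show "(\<integral>\<^sup>+x. ennreal (enn2real (\<integral>\<^sup>+y. ennreal (G x y * k y) \<partial>M2) powr q * w x) \<partial>M1)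
      \<le> ennreal (m powr q * D)" .
qed

subsection \<open>Power-weighted central Morrey spaces\<close>

lemma borel_measurable_power_weight [measurable]:
  "power_weight a \<in> borel_measurable (borel :: 'a::euclidean_space measure)"
  unfolding power_weight_def[abs_def] by measurable

lemma power_weight_nonneg [simp]: "0 \<le> power_weight a x"
  by (simp add: power_weight_def)

text \<open>Passes between the real-valued mass of the definition and the nonnegative integral in
  which all estimates are made.\<close>

lemma
  assumes a: "a > - real DIM('a::euclidean_space)"
  shows ennreal_weight_mass_power_weight: "r > 0 \<Longrightarrow>
      (\<integral>\<^sup>+x\<in>ball (0::'a) r. ennreal (norm x powr a) \<partial>lborel) =
      ennreal (r powr (a + DIM('a)) * weight_mass (power_weight a) (ball (0::'a) 1))"
    and weight_mass_power_weight_ball: "r > 0 \<Longrightarrow> weight_mass (power_weight a) (ball (0::'a) r) =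
      r powr (a + DIM('a)) * weight_mass (power_weight a) (ball (0::'a) 1)"
    and weight_mass_power_weight_pos: "0 < weight_mass (power_weight a) (ball (0::'a) 1)"
proof -
  \<comment> \<open>Valid for infinite integrals too, as both sides are then 0; finiteness is what
    later permits \<open>enn2real\<close> to be dropped.\<close>
  have wm: "weight_mass (power_weight a) (ball (0::'a) r) =
      enn2real (\<integral>\<^sup>+x\<in>ball (0::'a) r. ennreal (norm x powr a) \<partial>lborel)" for r
    unfolding weight_mass_def set_lebesgue_integral_def
    by (subst integral_eq_nn_integral)
      (auto simp: power_weight_def nn_integral_completion indicator_def
        intro!: measurable_completion arg_cong[where f=enn2real] nn_integral_cong split: if_splits)
  have fin: "(\<integral>\<^sup>+x\<in>ball (0::'a) 1. ennreal (norm x powr a) \<partial>lborel) < \<infinity>"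
    using a by (rule nn_integral_power_weight_finite)
  then have w1: "(\<integral>\<^sup>+x\<in>ball (0::'a) 1. ennreal (norm x powr a) \<partial>lborel) =
      ennreal (weight_mass (power_weight a) (ball (0::'a) 1))"
    by (simp add: wm less_top)
  show e: "(\<integral>\<^sup>+x\<in>ball (0::'a) r. ennreal (norm x powr a) \<partial>lborel) =
      ennreal (r powr (a + DIM('a)) * weight_mass (power_weight a) (ball (0::'a) 1))" if "r > 0" for r
    using that by (simp add: nn_integral_power_weight_ball w1 ennreal_mult')
  show "weight_mass (power_weight a) (ball (0::'a) r) =
      r powr (a + DIM('a)) * weight_mass (power_weight a) (ball (0::'a) 1)" if "r > 0"
    using that by (subst wm, subst e) (auto simp: wm)
  \<comment> \<open>Inside the ball the weight can vanish only at the origin, a null set, so a zero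
    integral would make the ball null.\<close>
  have "(\<integral>\<^sup>+x\<in>ball (0::'a) 1. ennreal (norm x powr a) \<partial>lborel) \<noteq> 0"
  proof
    assume "(\<integral>\<^sup>+x\<in>ball (0::'a) 1. ennreal (norm x powr a) \<partial>lborel) = 0"
    then have "AE x in lborel. ennreal (norm x powr a) * indicator (ball (0::'a) 1) x = 0"
      by (subst (asm) nn_integral_0_iff_AE) auto
    then have "AE x in lborel. x \<notin> ball (0::'a) 1"
      using AE_lborel_singleton[of 0] by eventually_elim (auto simp: indicator_def split: if_splits)
    then have "emeasure lborel (ball (0::'a) 1) = 0"
      by (subst (asm) AE_iff_measurable[OF _ refl]) (auto simp: ball_def)
    then show False
      using content_ball_gt_0_iff[of "0::'a" 1] by (simp add: measure_def)
  qed
  then show "0 < weight_mass (power_weight a) (ball (0::'a) 1)"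
    by (cases "0 < weight_mass (power_weight a) (ball (0::'a) 1)") (auto simp: w1 ennreal_neg)
qed

text \<open>Rewrites membership as growth of nonnegative integrals over balls. Raising the quotient
  bound to the power q turns l + 1/q into l * q + 1.\<close>

lemma morrey_spaceD:
  fixes f :: "'a::euclidean_space \<Rightarrow> complex"
  assumes f: "f \<in> morrey_space v (power_weight g) q l"
    and v: "\<And>R. R > 0 \<Longrightarrow> weight_mass v (ball 0 R) > 0" and q: "q > 0"
  defines "N \<equiv> morrey_norm v (power_weight g) q l f"
  shows "f \<in> borel_measurable lebesgue" and "N \<ge> 0"
    and "\<And>R. R > 0 \<Longrightarrow> morrey_quotient v (power_weight g) q l f R \<le> N"
    and "\<And>R. R > 0 \<Longrightarrow> set_integrable lebesgue (ball 0 R) (\<lambda>x. norm (f x) powr q * power_weight g x)"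
    and "\<And>R. R > 0 \<Longrightarrow> (\<integral>\<^sup>+x\<in>ball 0 R. ennreal (norm (f x) powr q * norm x powr g) \<partial>lborel)
      \<le> ennreal (N powr q * weight_mass v (ball 0 R) powr (l * q + 1))"
proof -
  show meas[measurable]: "f \<in> borel_measurable lebesgue"
    using f by (simp add: morrey_space_def)
  have bdd: "bdd_above (morrey_quotient v (power_weight g) q l f ` {0<..})"
    using f by (simp add: morrey_space_def)
  show le: "morrey_quotient v (power_weight g) q l f R \<le> N" if "R > 0" for R
    unfolding N_def morrey_norm_def using that bdd by (intro cSUP_upper) auto
  have "0 \<le> morrey_quotient v (power_weight g) q l f 1"
    by (simp add: morrey_quotient_def)
  also have "\<dots> \<le> N" by (intro le) simp
  finally show N: "N \<ge> 0" .
  show int: "set_integrable lebesgue (ball 0 R) (\<lambda>x. norm (f x) powr q * power_weight g x)" if "R > 0" for R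
  proof (rule set_integrable_subset)
    show "set_integrable lebesgue (cball 0 R) (\<lambda>x. norm (f x) powr q * power_weight g x)"
      using f by (simp add: morrey_space_def)
  qed auto
  show "(\<integral>\<^sup>+x\<in>ball 0 R. ennreal (norm (f x) powr q * norm x powr g) \<partial>lborel)
      \<le> ennreal (N powr q * weight_mass v (ball 0 R) powr (l * q + 1))" if R: "R > 0" for R
  proof -
    define I where "I = (LINT x:ball 0 R|lebesgue. norm (f x) powr q * power_weight g x)"
    define V where "V = weight_mass v (ball (0::'a) R)"
    have V: "V > 0" using v[OF R] by (simp add: V_def)
    have I0: "I \<ge> 0" unfolding I_def set_lebesgue_integral_def by (intro integral_nonneg_AE) auto
    have "(\<integral>\<^sup>+x\<in>ball 0 R. ennreal (norm (f x) powr q * norm x powr g) \<partial>lborel) =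
        (\<integral>\<^sup>+x. ennreal (indicator (ball 0 R) x *\<^sub>R (norm (f x) powr q * power_weight g x)) \<partial>lebesgue)"
      unfolding nn_integral_completion
      by (intro nn_integral_cong) (auto simp: indicator_def power_weight_def)
    also have "\<dots> = ennreal I"
      using int[OF R] unfolding I_def set_lebesgue_integral_def set_integrable_def
      by (intro nn_integral_eq_integral) auto
    finally have eq: "(\<integral>\<^sup>+x\<in>ball 0 R. ennreal (norm (f x) powr q * norm x powr g) \<partial>lborel) = ennreal I" .
    have "1 / V powr (l + 1 / q) * I powr (1 / q) \<le> N"
      using le[OF R] by (simp add: morrey_quotient_def V_def I_def)
    then have "I powr (1 / q) \<le> N * V powr (l + 1 / q)"
      using V by (simp add: field_simps)
    then have "(I powr (1 / q)) powr q \<le> (N * V powr (l + 1 / q)) powr q"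
      using q I0 by (intro powr_mono2) auto
    also have "\<dots> = N powr q * V powr ((l + 1 / q) * q)"
      using N by (simp add: powr_mult powr_powr)
    also have "(l + 1 / q) * q = l * q + 1" using q by (simp add: field_simps)
    also have "(I powr (1 / q)) powr q = I" using I0 q by (simp add: powr_powr)
    finally show ?thesis unfolding eq by (simp add: V_def ennreal_leI)
  qed
qed

text \<open>The converse passage: a growth bound on all balls yields integrability on compact sets,
  since each lies in a ball, and bounds the supremum.\<close>

lemma morrey_spaceI:
  fixes f :: "'a::euclidean_space \<Rightarrow> complex"
  assumes [measurable]: "f \<in> borel_measurable lebesgue"
    and v: "\<And>R. R > 0 \<Longrightarrow> weight_mass v (ball 0 R) > 0" and q: "q > 0" and N: "N \<ge> 0"
    and le: "\<And>R. R > 0 \<Longrightarrow> (\<integral>\<^sup>+x\<in>ball 0 R. ennreal (norm (f x) powr q * norm x powr g) \<partial>lborel)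
      \<le> ennreal (N powr q * weight_mass v (ball 0 R) powr (l * q + 1))"
  shows "f \<in> morrey_space v (power_weight g) q l"
    and "morrey_norm v (power_weight g) q l f \<le> N"
proof -
  have "power_weight g \<in> borel_measurable (lebesgue :: 'a measure)"
    by (intro measurable_completion) simp
  moreover have "(\<lambda>x. norm (f x) powr q) \<in> borel_measurable lebesgue"
    by measurable
  ultimately have meas: "(\<lambda>x. indicator (ball 0 R) x *\<^sub>R (norm (f x) powr q * power_weight g x))
      \<in> borel_measurable lebesgue" for R
    by (intro borel_measurable_scaleR borel_measurable_indicator borel_measurable_times) auto
  have eq: "(\<integral>\<^sup>+x. ennreal (indicator (ball 0 R) x *\<^sub>R (norm (f x) powr q * power_weight g x)) \<partial>lebesgue)
      = (\<integral>\<^sup>+x\<in>ball 0 R. ennreal (norm (f x) powr q * norm x powr g) \<partial>lborel)" for R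
    unfolding nn_integral_completion
    by (intro nn_integral_cong) (auto simp: indicator_def power_weight_def)
  have int: "set_integrable lebesgue (ball 0 R) (\<lambda>x. norm (f x) powr q * power_weight g x)" if "R > 0" for R
    unfolding set_integrable_def
  proof (rule integrableI_nonneg)
    show "(\<integral>\<^sup>+x. ennreal (indicator (ball 0 R) x *\<^sub>R (norm (f x) powr q * power_weight g x)) \<partial>lebesgue) < \<infinity>"
      unfolding eq using le[OF that] by (auto simp: less_top[symmetric] top_unique)
  qed (use meas in auto)
  have quot: "morrey_quotient v (power_weight g) q l f R \<le> N" if R: "R > 0" for R
  proof -
    define I where "I = (LINT x:ball 0 R|lebesgue. norm (f x) powr q * power_weight g x)"
    define V where "V = weight_mass v (ball (0::'a) R)"
    have V: "V > 0" using v[OF R] by (simp add: V_def)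
    have I0: "I \<ge> 0" unfolding I_def set_lebesgue_integral_def by (intro integral_nonneg_AE) auto
    have "ennreal I = (\<integral>\<^sup>+x\<in>ball 0 R. ennreal (norm (f x) powr q * norm x powr g) \<partial>lborel)"
      using int[OF R] unfolding I_def set_lebesgue_integral_def set_integrable_def eq[symmetric]
      by (intro nn_integral_eq_integral[symmetric]) auto
    also note le[OF R]
    finally have "I \<le> N powr q * V powr (l * q + 1)"
      by (simp add: V_def)
    then have "I powr (1 / q) \<le> (N powr q * V powr (l * q + 1)) powr (1 / q)"
      using q I0 by (intro powr_mono2) auto
    also have "\<dots> = N * V powr ((l * q + 1) * (1 / q))"
      using N q by (simp add: powr_mult powr_powr)
    also have "(l * q + 1) * (1 / q) = l + 1 / q" using q by (simp add: field_simps)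
    finally have "1 / V powr (l + 1 / q) * I powr (1 / q) \<le> N"
      using V by (simp add: field_simps)
    then show ?thesis by (simp add: morrey_quotient_def V_def I_def)
  qed
  show "f \<in> morrey_space v (power_weight g) q l"
    unfolding morrey_space_def
  proof (intro CollectI conjI allI impI)
    fix K :: "'a set" assume K: "compact K"
    then obtain R where R: "R > 0" "K \<subseteq> ball 0 R"
      using bounded_subset_ballD[OF compact_imp_bounded, of K 0] by auto
    show "set_integrable lebesgue K (\<lambda>x. norm (f x) powr q * power_weight g x)"
      by (rule set_integrable_subset[OF int[OF R(1)] _ R(2)]) (use K lmeasurable_compact in blast)
  next
    show "bdd_above (morrey_quotient v (power_weight g) q l f ` {0<..})"
      using quot by (intro bdd_aboveI[of _ N]) auto
  qed simp
  show "morrey_norm v (power_weight g) q l f \<le> N"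
    unfolding morrey_norm_def using quot by (intro cSUP_least) auto
qed

subsection \<open>Quasiconformal substitutions\<close>

text \<open>The sign of e decides which of the two ratio bounds is used; the absolute value in the
  exponent covers both cases.\<close>

lemma powr_le_of_ratio_le:
  fixes a b :: real
  assumes "a > 0" "b > 0" "a \<le> \<rho> * b" "b \<le> \<rho> * a"
  shows "a powr e \<le> \<rho> powr \<bar>e\<bar> * b powr e"
proof -
  have "(a / b) powr e \<le> \<rho> powr \<bar>e\<bar>"
  proof (cases "e \<ge> 0")
    case True
    then show ?thesis using assms powr_mono2[of e "a / b" \<rho>] by (simp add: field_simps)
  next
    case False
    have "(a / b) powr e = (b / a) powr - e"
      using assms by (simp add: powr_divide powr_minus field_simps)
    also have "\<dots> \<le> \<rho> powr - e"
      using False assms by (intro powr_mono2) (auto simp: field_simps)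
    finally show ?thesis using False by simp
  qed
  then show ?thesis using assms by (simp add: powr_divide field_simps)
qed

lemma norm_matrix_vector_mult_le:
  fixes A :: "real^'n^'m"
  shows "norm (A *v x) \<le> norm A * norm x"
proof -
  have "norm (A *v x) = L2_set (\<lambda>i. \<bar>A $ i \<bullet> x\<bar>) UNIV"
    by (simp add: norm_vec_def matrix_vector_mul_component)
  also have "\<dots> \<le> L2_set (\<lambda>i. norm (A $ i) * norm x) UNIV"
    by (intro L2_set_mono) (auto simp: Cauchy_Schwarz_ineq2)
  also have "\<dots> = norm A * norm x"
    by (simp add: L2_set_left_distrib norm_vec_def)
  finally show ?thesis .
qed

text \<open>Everything follows from \<open>x = matrix_inv A *v (A *v x)\<close>: a unit vector gives
  the lower bound 1 for the product of norms, and multiplication by \<open>norm A\<close> gives the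
  expansion estimate.\<close>

lemma
  fixes A :: "real^'n^'n"
  assumes inv: "invertible A" and \<rho>: "norm A * norm (matrix_inv A) \<le> \<rho>"
  shows norm_invertible_pos: "norm A > 0" and norm_matrix_inv_pos: "norm (matrix_inv A) > 0"
    and norm_matrix_inv_ge: "1 \<le> norm A * norm (matrix_inv A)"
    and norm_matrix_vector_mult_ge: "norm A / \<rho> * norm x \<le> norm (A *v x)"
proof -
  have left: "matrix_inv A ** A = mat 1"
    using someI_ex[OF inv[unfolded invertible_def]] by (simp add: matrix_inv_def)
  have le: "norm x \<le> norm (matrix_inv A) * norm (A *v x)" for x
  proof -
    have "x = matrix_inv A *v (A *v x)"
      by (simp add: matrix_vector_mul_assoc left)
    then show ?thesis using norm_matrix_vector_mult_le[of "matrix_inv A" "A *v x"] by simp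
  qed
  obtain b :: "real^'n" where b: "norm b = 1" using vector_choose_size[of 1] by auto
  have "1 \<le> norm (matrix_inv A) * norm (A *v b)" using le[of b] b by simp
  also have "\<dots> \<le> norm (matrix_inv A) * norm A"
    using norm_matrix_vector_mult_le[of A b] b by (intro mult_left_mono) auto
  finally show ge: "1 \<le> norm A * norm (matrix_inv A)" by (simp add: mult.commute)
  then have "norm A \<noteq> 0" "norm (matrix_inv A) \<noteq> 0" by (auto simp del: norm_eq_zero)
  then show "norm A > 0" "norm (matrix_inv A) > 0" by auto
  have "norm A * norm x \<le> norm A * (norm (matrix_inv A) * norm (A *v x))"
    using le by (intro mult_left_mono) auto
  also have "\<dots> = (norm A * norm (matrix_inv A)) * norm (A *v x)" by simp
  also have "\<dots> \<le> \<rho> * norm (A *v x)"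
    using \<rho> by (intro mult_right_mono) auto
  finally show "norm A / \<rho> * norm x \<le> norm (A *v x)"
    using ge \<rho> by (simp add: field_simps)
qed

text \<open>Replacing \<open>norm x\<close> by \<open>norm (T x) / t\<close> in the weight costs
  \<open>\<rho> powr \<bar>g\<bar>\<close>, and the Jacobian is at most
  \<open>(\<rho> / t) ^ DIM('a)\<close>; T maps the ball of radius R into that of radius t *
  R.\<close>

lemma nn_integral_quasiconformal_comp_le:
  fixes T :: "'a::euclidean_space \<Rightarrow> 'a" and h :: "'a \<Rightarrow> real"
  assumes [measurable]: "h \<in> borel_measurable borel" and h: "\<And>x. h x \<ge> 0"
    and T: "linear T" and t: "t > 0" and \<rho>: "\<rho> \<ge> 1"
    and lower: "\<And>x. t / \<rho> * norm x \<le> norm (T x)" and upper: "\<And>x. norm (T x) \<le> t * norm x"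
  shows "(\<integral>\<^sup>+x\<in>ball 0 R. ennreal (h (T x) * norm x powr g) \<partial>lborel) \<le>
    ennreal (\<rho> powr (\<bar>g\<bar> + DIM('a)) * t powr (- g - DIM('a))) *
    (\<integral>\<^sup>+x\<in>ball 0 (t * R). ennreal (h x * norm x powr g) \<partial>lborel)"
proof -
  define u where "u z = ennreal (h z * norm z powr g) * indicator (ball 0 (t * R)) z" for z
  have [measurable]: "u \<in> borel_measurable borel" unfolding u_def[abs_def] by measurable
  have [measurable]: "T \<in> borel_measurable borel"
    using T by (intro borel_measurable_continuous_onI linear_continuous_on) (simp add: linear_conv_bounded_linear)
  have "(\<integral>\<^sup>+x\<in>ball 0 R. ennreal (h (T x) * norm x powr g) \<partial>lborel) \<le>
      (\<integral>\<^sup>+x. ennreal (\<rho> powr \<bar>g\<bar> * t powr - g) * u (T x) \<partial>lborel)"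
  proof (rule nn_integral_mono, goal_cases)
    case (1 x)
    \<comment> \<open>The ratio argument needs x nonzero; at the origin the left side is 0 because
      \<open>0 powr g = 0\<close>.\<close>
    show ?case
    proof (cases "x \<in> ball 0 R \<and> x \<noteq> 0")
      case True
      then have x: "norm x > 0" "norm x < R" by auto
      have Tx: "norm (T x) > 0"
        using x t \<rho> by (intro order.strict_trans2[OF _ lower]) simp
      have "T x \<in> ball 0 (t * R)"
        using upper[of x] x t by (simp add: order.strict_trans1[OF _ mult_strict_left_mono])
      moreover have "norm x powr g \<le> \<rho> powr \<bar>g\<bar> * t powr - g * norm (T x) powr g"
      proof -
        have "1 * (t * norm x) \<le> \<rho> * (t * norm x)"
          using \<rho> t by (intro mult_right_mono) auto
        then have "norm (T x) \<le> \<rho> * (t * norm x)"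
          using upper[of x] by linarith
        moreover have "t * norm x \<le> \<rho> * norm (T x)"
          using lower[of x] \<rho> by (simp add: field_simps)
        ultimately have "(t * norm x) powr g \<le> \<rho> powr \<bar>g\<bar> * norm (T x) powr g"
          using x t Tx by (intro powr_le_of_ratio_le) auto
        then show ?thesis
          using t x by (simp add: powr_mult powr_minus field_simps)
      qed
      from mult_left_mono[OF this h[of "T x"]]
      have "h (T x) * norm x powr g \<le> \<rho> powr \<bar>g\<bar> * t powr - g * (h (T x) * norm (T x) powr g)"
        by (simp only: mult.left_commute[of "h (T x)"])
      ultimately show ?thesis
        using True h by (simp add: u_def ennreal_mult[symmetric] ennreal_leI)
    qed auto
  qed
  also have "\<dots> = ennreal (\<rho> powr \<bar>g\<bar> * t powr - g) * (\<integral>\<^sup>+x. u (T x) \<partial>lborel)"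
    by (rule nn_integral_cmult) measurable
  also have "\<dots> \<le> ennreal (\<rho> powr \<bar>g\<bar> * t powr - g) * (ennreal ((1 / (t / \<rho>)) ^ DIM('a)) * (\<integral>\<^sup>+x. u x \<partial>lborel))"
    using t \<rho> T lower by (intro mult_left_mono nn_integral_linear_comp_le) auto
  also have "\<dots> = ennreal (\<rho> powr \<bar>g\<bar> * t powr - g * (1 / (t / \<rho>)) ^ DIM('a)) * (\<integral>\<^sup>+x. u x \<partial>lborel)"
  proof -
    have "ennreal (\<rho> powr \<bar>g\<bar> * t powr - g) * ennreal ((1 / (t / \<rho>)) ^ DIM('a)) =
        ennreal (\<rho> powr \<bar>g\<bar> * t powr - g * (1 / (t / \<rho>)) ^ DIM('a))"
      using t \<rho> by (intro ennreal_mult[symmetric]) auto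
    then show ?thesis by (simp only: mult.assoc[symmetric])
  qed
  also have "\<rho> powr \<bar>g\<bar> * t powr - g * (1 / (t / \<rho>)) ^ DIM('a) =
      \<rho> powr (\<bar>g\<bar> + DIM('a)) * t powr (- g - DIM('a))"
    using t \<rho> by (simp add: powr_add powr_diff powr_realpow power_divide)
  finally show ?thesis unfolding u_def .
qed

section \<open>Exponent arithmetic and the Hoelder estimate at fixed y\<close>

locale morrey_exponents =
  fixes n \<beta> \<gamma> q l :: real and \<beta>s \<gamma>s qs ls :: "'m::finite \<Rightarrow> real"
  assumes n: "n > 0"
    and \<beta>: "\<beta> > - n" and \<gamma>: "\<gamma> > - n" and \<beta>s: "\<beta>s i > - n" and \<gamma>s: "\<gamma>s i > - n"
    and q: "q \<ge> 1" and qs: "qs i \<ge> 1" and sum_qs: "(\<Sum>i\<in>UNIV. 1 / qs i) = 1 / q"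
    and l: "1 + l * q > 0" and ls: "1 + ls i * qs i > 0"
    and sum_\<beta>s: "(\<Sum>i\<in>UNIV. \<beta>s i / qs i) = \<beta> / q"
    and sum_ls: "(\<Sum>i\<in>UNIV. (n + \<beta>s i) / (n + \<beta>) * ls i) = l"
    and sum_\<gamma>s: "(\<Sum>i\<in>UNIV. \<gamma>s i / qs i) = \<gamma> / q"
begin

text \<open>The critical degree of the i-th source space: integrating \<open>norm x powr s i\<close>
  to the power \<open>qs i\<close> against its weight over a ball of radius R gives a multiple of
  \<open>R powr ((\<beta>s i + n) * (ls i * qs i + 1))\<close>, the growth that the space
  allows.\<close>

definition s :: "'m \<Rightarrow> real"
  where "s i = (\<beta>s i + n) * ls i + (\<beta>s i - \<gamma>s i) / qs i"

lemma sum_ls': "(\<Sum>i\<in>UNIV. (\<beta>s i + n) * ls i) = (\<beta> + n) * l"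
proof -
  have "(\<beta> + n) * l = (\<Sum>i\<in>UNIV. (\<beta> + n) * ((n + \<beta>s i) / (n + \<beta>) * ls i))"
    by (simp add: sum_ls[symmetric] sum_distrib_left)
  also have "\<dots> = (\<Sum>i\<in>UNIV. (\<beta>s i + n) * ls i)"
    using \<beta> by (intro sum.cong refl) (simp add: field_simps)
  finally show ?thesis ..
qed

lemma sum_s: "(\<Sum>i\<in>UNIV. s i) = (\<beta> + n) * l + (\<beta> - \<gamma>) / q"
  by (simp add: s_def sum.distrib sum_ls' diff_divide_distrib sum_subtractf sum_\<beta>s sum_\<gamma>s)

text \<open>Says that the powers of R allowed in the source spaces multiply to the one allowed in
  the target.\<close>

lemma sum_scaling: "(\<Sum>i\<in>UNIV. (\<beta>s i + n) * (ls i + 1 / qs i)) = (\<beta> + n) * (l + 1 / q)"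
proof -
  have "(\<Sum>i\<in>UNIV. (\<beta>s i + n) * (ls i + 1 / qs i)) =
      (\<Sum>i\<in>UNIV. (\<beta>s i + n) * ls i) + (\<Sum>i\<in>UNIV. \<beta>s i / qs i) + n * (\<Sum>i\<in>UNIV. 1 / qs i)"
    by (simp add: sum.distrib[symmetric] sum_distrib_left distrib_left add_divide_distrib add.assoc)
  then show ?thesis
    unfolding sum_ls' sum_\<beta>s sum_qs by (simp add: distrib_left add_divide_distrib)
qed

text \<open>The cost of one factor: distortion from the substitution, and \<open>\<kappa> i\<close>,
  which will be the mass of the unit ball for the i-th weight; the outer root undoes the power
  \<open>qs i\<close>.\<close>

definition c :: "real \<Rightarrow> ('m \<Rightarrow> real) \<Rightarrow> 'm \<Rightarrow> real"
  where "c \<rho> \<kappa> i = (\<rho> powr (\<bar>\<gamma>s i\<bar> + n) * \<kappa> i powr (ls i * qs i + 1)) powr (1 / qs i)"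

text \<open>The factors \<open>t i powr - s i\<close> make the bound free of t. Applied to the maps
  \<open>A i y\<close>, it is thus uniform in y, as Minkowski's inequality requires.\<close>

lemma nn_integral_prod_quasiconformal_le:
  fixes T :: "'m \<Rightarrow> 'a::euclidean_space \<Rightarrow> 'a" and h :: "'m \<Rightarrow> 'a \<Rightarrow> real"
  assumes dim: "n = DIM('a)"
    and [measurable]: "\<And>i. h i \<in> borel_measurable borel" and h: "\<And>i x. h i x \<ge> 0"
    and T: "\<And>i. linear (T i)" and t: "\<And>i. t i > 0" and \<rho>: "\<rho> \<ge> 1"
    and lower: "\<And>i x. t i / \<rho> * norm x \<le> norm (T i x)"
    and upper: "\<And>i x. norm (T i x) \<le> t i * norm x"
    and N: "\<And>i. N i \<ge> 0" and \<kappa>: "\<And>i. \<kappa> i > 0" and R: "R > 0"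
    and le: "\<And>i R. R > 0 \<Longrightarrow> (\<integral>\<^sup>+x\<in>ball 0 R. ennreal (h i x powr qs i * norm x powr \<gamma>s i) \<partial>lborel)
      \<le> ennreal (N i powr qs i * (R powr (\<beta>s i + n) * \<kappa> i) powr (ls i * qs i + 1))"
  shows "(\<integral>\<^sup>+x\<in>ball 0 R. ennreal ((\<Prod>i\<in>UNIV. h i (T i x) * t i powr - s i) powr q * norm x powr \<gamma>) \<partial>lborel)
    \<le> ennreal ((\<Prod>i\<in>UNIV. c \<rho> \<kappa> i * N i) powr q * R powr ((\<beta> + n) * (l * q + 1)))"
proof -
  \<comment> \<open>The i-th factor raised to the power \<open>qs i\<close>, with its own weight;
    Hoelder with weights \<open>q / qs i\<close> then reassembles the q-th power of the product and
    the weight of degree \<open>\<gamma>\<close>.\<close>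
  define a where "a i x = t i powr (- s i * qs i) * (h i (T i x) powr qs i * norm x powr \<gamma>s i * indicator (ball 0 R) x)" for i x
  define \<theta> where "\<theta> i = q / qs i" for i
  define N' where "N' i = (c \<rho> \<kappa> i * N i) powr qs i * R powr ((\<beta>s i + n) * (ls i * qs i + 1))" for i
  have qs0: "qs i > 0" "qs i \<noteq> 0" for i using qs[of i] by auto
  have q0: "q > 0" using q by simp
  have c0: "c \<rho> \<kappa> i \<ge> 0" for i by (simp add: c_def)
  have [measurable]: "T i \<in> borel_measurable borel" for i
    using T[of i] by (intro borel_measurable_continuous_onI linear_continuous_on) (simp add: linear_conv_bounded_linear)
  have "(\<integral>\<^sup>+x. ennreal (\<Prod>i\<in>UNIV. a i x powr \<theta> i) \<partial>lborel) \<le> ennreal (\<Prod>i\<in>UNIV. N' i powr \<theta> i)"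
  proof (rule nn_integral_Holder)
    show "(\<Sum>i\<in>UNIV. \<theta> i) = 1"
      using sum_qs q0 unfolding \<theta>_def by (simp add: divide_inverse sum_distrib_left[symmetric])
    show "a i \<in> borel_measurable lborel" for i
      unfolding a_def[abs_def] by measurable
    show "a i x \<ge> 0" for i x using h by (simp add: a_def)
    show "(\<integral>\<^sup>+x. ennreal (a i x) \<partial>lborel) \<le> ennreal (N' i)" for i
    proof -
      have "(\<integral>\<^sup>+x. ennreal (a i x) \<partial>lborel) =
          ennreal (t i powr (- s i * qs i)) * (\<integral>\<^sup>+x\<in>ball 0 R. ennreal (h i (T i x) powr qs i * norm x powr \<gamma>s i) \<partial>lborel)"
        by (subst nn_integral_cmult[symmetric])
          (auto simp: a_def ennreal_mult' indicator_def intro!: nn_integral_cong)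
      also have "\<dots> \<le> ennreal (t i powr (- s i * qs i)) *
          (ennreal (\<rho> powr (\<bar>\<gamma>s i\<bar> + DIM('a)) * t i powr (- \<gamma>s i - DIM('a))) *
            (\<integral>\<^sup>+x\<in>ball 0 (t i * R). ennreal (h i x powr qs i * norm x powr \<gamma>s i) \<partial>lborel))"
        using T t \<rho> lower upper
        by (intro mult_left_mono nn_integral_quasiconformal_comp_le[where h="\<lambda>x. h i x powr qs i"]) auto
      also have "\<dots> \<le> ennreal (t i powr (- s i * qs i)) *
          (ennreal (\<rho> powr (\<bar>\<gamma>s i\<bar> + DIM('a)) * t i powr (- \<gamma>s i - DIM('a))) *
            ennreal (N i powr qs i * ((t i * R) powr (\<beta>s i + n) * \<kappa> i) powr (ls i * qs i + 1)))"
        using t[of i] R by (intro mult_left_mono le) auto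
      also have "\<dots> = ennreal (t i powr (- s i * qs i) * (\<rho> powr (\<bar>\<gamma>s i\<bar> + n) * t i powr (- \<gamma>s i - n) *
          (N i powr qs i * ((t i * R) powr (\<beta>s i + n) * \<kappa> i) powr (ls i * qs i + 1))))"
        using dim by (simp add: ennreal_mult)
      also have "t i powr (- s i * qs i) * (\<rho> powr (\<bar>\<gamma>s i\<bar> + n) * t i powr (- \<gamma>s i - n) *
          (N i powr qs i * ((t i * R) powr (\<beta>s i + n) * \<kappa> i) powr (ls i * qs i + 1))) =
        (t i powr (- s i * qs i) * t i powr (- \<gamma>s i - n) * t i powr ((\<beta>s i + n) * (ls i * qs i + 1))) *
        ((\<rho> powr (\<bar>\<gamma>s i\<bar> + n) * \<kappa> i powr (ls i * qs i + 1)) * N i powr qs i *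
          R powr ((\<beta>s i + n) * (ls i * qs i + 1)))"
        using t[of i] R \<kappa>[of i] by (simp add: powr_mult powr_powr)
      also have "t i powr (- s i * qs i) * t i powr (- \<gamma>s i - n) * t i powr ((\<beta>s i + n) * (ls i * qs i + 1)) =
          t i powr (- s i * qs i + (- \<gamma>s i - n) + (\<beta>s i + n) * (ls i * qs i + 1))"
        by (simp only: powr_add)
      \<comment> \<open>The identity that dictates \<open>s i\<close>: the powers of
        \<open>t i\<close> from the normalisation, from the substitution and from the enlarged
        radius \<open>t i * R\<close> cancel.\<close>
      also have "- s i * qs i + (- \<gamma>s i - n) + (\<beta>s i + n) * (ls i * qs i + 1) = 0"
        using qs0[of i] unfolding s_def by (simp add: field_simps)
      also have "\<rho> powr (\<bar>\<gamma>s i\<bar> + n) * \<kappa> i powr (ls i * qs i + 1) = c \<rho> \<kappa> i powr qs i"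
        using qs0[of i] \<rho> \<kappa>[of i] unfolding c_def by (simp add: powr_powr)
      also have "t i powr 0 * (c \<rho> \<kappa> i powr qs i * N i powr qs i * R powr ((\<beta>s i + n) * (ls i * qs i + 1))) = N' i"
        using t[of i] N[of i] c0[of i] by (simp add: N'_def powr_mult)
      finally show ?thesis .
    qed
  qed (use qs0 q0 in \<open>auto simp: \<theta>_def N'_def\<close>)
  moreover have "ennreal ((\<Prod>i\<in>UNIV. h i (T i x) * t i powr - s i) powr q * norm x powr \<gamma>) * indicator (ball 0 R) x
      \<le> ennreal (\<Prod>i\<in>UNIV. a i x powr \<theta> i)" for x
  proof (cases "x \<in> ball 0 R \<and> x \<noteq> 0")
    case True
    have "a i x powr \<theta> i = (h i (T i x) * t i powr - s i) powr q * norm x powr (\<gamma>s i / qs i * q)" for i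
      using True h[of i "T i x"] t[of i] qs0[of i] unfolding a_def \<theta>_def
      by (simp add: powr_mult powr_powr mult_ac)
    then have "(\<Prod>i\<in>UNIV. a i x powr \<theta> i) =
        (\<Prod>i\<in>UNIV. (h i (T i x) * t i powr - s i) powr q) * (\<Prod>i\<in>UNIV. norm x powr (\<gamma>s i / qs i * q))"
      by (simp add: prod.distrib)
    also have "(\<Prod>i\<in>UNIV. norm x powr (\<gamma>s i / qs i * q)) = norm x powr (\<Sum>i\<in>UNIV. \<gamma>s i / qs i * q)"
      using True by (simp add: powr_sum)
    also have "(\<Sum>i\<in>UNIV. \<gamma>s i / qs i * q) = \<gamma>"
      using q0 by (simp only: sum_distrib_right[symmetric] sum_\<gamma>s) simp
    also have "(\<Prod>i\<in>UNIV. (h i (T i x) * t i powr - s i) powr q) = (\<Prod>i\<in>UNIV. h i (T i x) * t i powr - s i) powr q"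
      by (rule prod_powr_distrib[symmetric])
    finally show ?thesis using True by simp
  qed auto
  ultimately have "(\<integral>\<^sup>+x\<in>ball 0 R. ennreal ((\<Prod>i\<in>UNIV. h i (T i x) * t i powr - s i) powr q * norm x powr \<gamma>) \<partial>lborel)
      \<le> ennreal (\<Prod>i\<in>UNIV. N' i powr \<theta> i)"
    by (meson nn_integral_mono order_trans)
  also have "(\<Prod>i\<in>UNIV. N' i powr \<theta> i) = (\<Prod>i\<in>UNIV. (c \<rho> \<kappa> i * N i) powr q * R powr ((\<beta>s i + n) * (ls i + 1 / qs i) * q))"
  proof (intro prod.cong refl)
    fix i
    have "(\<beta>s i + n) * (ls i * qs i + 1) * (q / qs i) = (\<beta>s i + n) * (ls i + 1 / qs i) * q"
      using qs0[of i] by (simp add: field_simps)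
    then show "N' i powr \<theta> i = (c \<rho> \<kappa> i * N i) powr q * R powr ((\<beta>s i + n) * (ls i + 1 / qs i) * q)"
      using qs0[of i] c0[of i] N[of i] R unfolding N'_def \<theta>_def by (simp add: powr_mult powr_powr)
  qed
  also have "\<dots> = (\<Prod>i\<in>UNIV. c \<rho> \<kappa> i * N i) powr q * R powr (\<Sum>i\<in>UNIV. (\<beta>s i + n) * (ls i + 1 / qs i) * q)"
    using R unfolding prod_powr_distrib[of "\<lambda>i. c \<rho> \<kappa> i * N i"]
      prod.distrib[of "\<lambda>i. (c \<rho> \<kappa> i * N i) powr q"] by (simp add: powr_sum)
  also have "(\<Sum>i\<in>UNIV. (\<beta>s i + n) * (ls i + 1 / qs i) * q) = (\<beta> + n) * (l * q + 1)"
    using q0 by (simp only: sum_distrib_right[symmetric] sum_scaling) (simp add: field_simps)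
  finally show ?thesis .
qed

end

subsection \<open>The operator for Borel data\<close>

lemma measurable_matrix_vector_mult [measurable]:
  fixes f :: "'a \<Rightarrow> real^'n^'m"
  assumes "f \<in> borel_measurable M" "g \<in> borel_measurable M"
  shows "(\<lambda>x. f x *v g x) \<in> borel_measurable M"
  using assms
proof (rule borel_measurable_continuous_Pair)
  show "continuous_on UNIV (\<lambda>p::(real^'n^'m) \<times> (real^'n). fst p *v snd p)"
    unfolding matrix_vector_mult_def by (intro continuous_intros)
qed

lemma borel_measurable_hausdorff_integrand:
  fixes \<Phi> :: "real^'n \<Rightarrow> complex" and A :: "'m::finite \<Rightarrow> real^'n \<Rightarrow> real^'n^'n"
  assumes [measurable]: "\<Phi> \<in> borel_measurable borel"
    "\<And>i. A i \<in> borel_measurable borel" "\<And>i. g i \<in> borel_measurable borel"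
  shows "(\<lambda>(x, y). hausdorff_integrand \<Phi> A g x y) \<in> borel_measurable (lborel \<Otimes>\<^sub>M lborel)"
  unfolding hausdorff_integrand_def by measurable

text \<open>A non-integrable f has integral 0, so the bound holds for it as well and no
  measurability has to be checked.\<close>

lemma norm_integral_le_nn_integral:
  fixes f :: "'a \<Rightarrow> 'b::{banach, second_countable_topology}"
  assumes "(\<integral>\<^sup>+x. norm (f x) \<partial>M) < \<infinity>"
  shows "norm (integral\<^sup>L M f) \<le> enn2real (\<integral>\<^sup>+x. norm (f x) \<partial>M)"
proof (cases "integrable M f")
  case True
  from enn2real_mono[OF integral_norm_bound_ennreal[OF True]] assms show ?thesis by simp
qed (simp add: not_integrable_integral_eq)

context morrey_exponents
begin

text \<open>Minkowski over y: the estimate at fixed y supplies the uniform bound, and m bounds the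
  total mass of the kernel.\<close>

lemma
  fixes \<Phi> :: "real^'n \<Rightarrow> complex" and A :: "'m \<Rightarrow> real^'n \<Rightarrow> real^'n^'n"
  assumes dim: "n = real CARD('n)"
    and [measurable]: "\<Phi> \<in> borel_measurable borel"
      "\<And>i. A i \<in> borel_measurable borel" "\<And>i. g i \<in> borel_measurable borel"
    and \<rho>: "\<rho> \<ge> 1"
    and conf: "AE y in lborel. \<forall>i. norm (A i y) > 0 \<and> (\<forall>x. norm (A i y) / \<rho> * norm x \<le> norm (A i y *v x))"
    and m: "m \<ge> 0" "(\<integral>\<^sup>+y. ennreal (norm (\<Phi> y) / norm y ^ CARD('n) * (\<Prod>i\<in>UNIV. norm (A i y) powr s i)) \<partial>lborel) \<le> ennreal m"
    and N: "\<And>i. N i \<ge> 0" and \<kappa>: "\<And>i. \<kappa> i > 0"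
    and le: "\<And>i R. R > 0 \<Longrightarrow> (\<integral>\<^sup>+x\<in>ball 0 R. ennreal (norm (g i x) powr qs i * norm x powr \<gamma>s i) \<partial>lborel)
      \<le> ennreal (N i powr qs i * (R powr (\<beta>s i + n) * \<kappa> i) powr (ls i * qs i + 1))"
  shows AE_nn_integral_hausdorff_integrand_finite:
      "AE x in lborel. (\<integral>\<^sup>+y. norm (hausdorff_integrand \<Phi> A g x y) \<partial>lborel) < \<infinity>"
    and nn_integral_hausdorff_op_le: "\<And>R. R > 0 \<Longrightarrow>
      (\<integral>\<^sup>+x\<in>ball 0 R. ennreal (norm (hausdorff_op \<Phi> A g x) powr q * norm x powr \<gamma>) \<partial>lborel)
        \<le> ennreal (m powr q * ((\<Prod>i\<in>UNIV. c \<rho> \<kappa> i * N i) powr q * R powr ((\<beta> + n) * (l * q + 1))))"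
proof -
  \<comment> \<open>The powers of \<open>norm (A i y)\<close> are put into the kernel and divided
    out of \<open>G\<close>, so that the bound \<open>D R\<close> on \<open>G\<close> does not
    depend on y.\<close>
  define k where "k y = norm (\<Phi> y) / norm y ^ CARD('n) * (\<Prod>i\<in>UNIV. norm (A i y) powr s i)" for y
  define G where "G x y = (\<Prod>i\<in>UNIV. norm (g i (A i y *v x)) * norm (A i y) powr - s i)" for x y
  define w where "w R x = norm x powr \<gamma> * indicator (ball 0 R) x" for R and x :: "real^'n"
  define D where "D R = (\<Prod>i\<in>UNIV. c \<rho> \<kappa> i * N i) powr q * R powr ((\<beta> + n) * (l * q + 1))" for R
  define h where "h x = (\<integral>\<^sup>+y. norm (hausdorff_integrand \<Phi> A g x y) \<partial>lborel)" for x
  have [measurable]: "(\<lambda>(x, y). hausdorff_integrand \<Phi> A g x y) \<in> borel_measurable (lborel \<Otimes>\<^sub>M lborel)"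
    by (rule borel_measurable_hausdorff_integrand) measurable
  have Gk: "(\<integral>\<^sup>+y. ennreal (G x y * k y) \<partial>lborel) = h x" for x
    unfolding h_def
  proof (rule nn_integral_cong_AE, use conf in eventually_elim)
    fix y assume y: "\<forall>i. norm (A i y) > 0 \<and> (\<forall>x. norm (A i y) / \<rho> * norm x \<le> norm (A i y *v x))"
    \<comment> \<open>Cancellation relies on a positive norm: with \<open>0 powr e = 0\<close> the
      product would be 0, not 1.\<close>
    have "norm (A i y) powr - s i * norm (A i y) powr s i = 1" for i
      using y by (simp add: powr_minus)
    then have "G x y * (\<Prod>i\<in>UNIV. norm (A i y) powr s i) = (\<Prod>i\<in>UNIV. norm (g i (A i y *v x)))"
      unfolding G_def prod.distrib[symmetric] mult.assoc by simp
    then have "G x y * k y = norm (hausdorff_integrand \<Phi> A g x y)"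
      by (simp add: k_def hausdorff_integrand_def norm_mult norm_divide prod_norm[symmetric] norm_power mult_ac)
    then show "ennreal (G x y * k y) = ennreal (norm (hausdorff_integrand \<Phi> A g x y))" by simp
  qed
  have Mink: "AE x in lborel. w R x > 0 \<longrightarrow> h x < \<infinity>"
    "(\<integral>\<^sup>+x. ennreal (enn2real (h x) powr q * w R x) \<partial>lborel) \<le> ennreal (m powr q * D R)"
    if R: "R > 0" for R
  proof -
    have 1: "case_prod G \<in> borel_measurable (lborel \<Otimes>\<^sub>M lborel)"
      unfolding G_def[abs_def] by measurable
    have 2: "w R \<in> borel_measurable lborel" "k \<in> borel_measurable lborel"
      unfolding w_def[abs_def] k_def[abs_def] by measurable
    have 3: "G x y \<ge> 0" "w R x \<ge> 0" "k y \<ge> 0" "D R \<ge> 0" for x y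
      unfolding G_def w_def k_def D_def by (auto intro!: prod_nonneg mult_nonneg_nonneg divide_nonneg_nonneg)
    have 4: "AE y in lborel. (\<integral>\<^sup>+x. ennreal (G x y powr q * w R x) \<partial>lborel) \<le> ennreal (D R)"
      using conf
    proof eventually_elim
      fix y assume y: "\<forall>i. norm (A i y) > 0 \<and> (\<forall>x. norm (A i y) / \<rho> * norm x \<le> norm (A i y *v x))"
      have "(\<integral>\<^sup>+x. ennreal (G x y powr q * w R x) \<partial>lborel) =
          (\<integral>\<^sup>+x\<in>ball 0 R. ennreal ((\<Prod>i\<in>UNIV. norm (g i (A i y *v x)) * norm (A i y) powr - s i) powr q * norm x powr \<gamma>) \<partial>lborel)"
        by (intro nn_integral_cong) (auto simp: G_def w_def indicator_def)
      also have "\<dots> \<le> ennreal (D R)"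
        unfolding D_def
        by (rule nn_integral_prod_quasiconformal_le[where h="\<lambda>i x. norm (g i x)" and T="\<lambda>i x. A i y *v x"])
          (use dim y \<rho> N \<kappa> R le norm_matrix_vector_mult_le[of "A _ y"] in auto)
      finally show "(\<integral>\<^sup>+x. ennreal (G x y powr q * w R x) \<partial>lborel) \<le> ennreal (D R)" .
    qed
    note M = lborel_pair.nn_integral_Minkowski[OF q 1 2 3(1-3) m(1) m(2)[folded k_def] 3(4) 4]
    show "AE x in lborel. w R x > 0 \<longrightarrow> h x < \<infinity>"
      "(\<integral>\<^sup>+x. ennreal (enn2real (h x) powr q * w R x) \<partial>lborel) \<le> ennreal (m powr q * D R)"
      using M unfolding Gk by auto
  qed
  \<comment> \<open>Each radius gives finiteness only inside its ball and where the weight is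
    positive. Countably many radii exhaust the space minus the origin; \<open>Suc\<close> keeps them
    positive.\<close>
  have "AE x in lborel. \<forall>j::nat. w (real (Suc j)) x > 0 \<longrightarrow> h x < \<infinity>"
    unfolding AE_all_countable by (intro allI Mink) simp
  then have fin: "AE x in lborel. h x < \<infinity>"
    using AE_lborel_singleton[of "0::real^'n"]
  proof eventually_elim
    fix x :: "real^'n" assume x: "\<forall>j::nat. w (real (Suc j)) x > 0 \<longrightarrow> h x < \<infinity>" "x \<noteq> 0"
    obtain j :: nat where "norm x < real j" using reals_Archimedean2 by blast
    then have "w (real (Suc j)) x > 0" using x by (simp add: w_def)
    with x show "h x < \<infinity>" by blast
  qed
  then show "AE x in lborel. (\<integral>\<^sup>+y. norm (hausdorff_integrand \<Phi> A g x y) \<partial>lborel) < \<infinity>"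
    by (simp add: h_def)
  show "(\<integral>\<^sup>+x\<in>ball 0 R. ennreal (norm (hausdorff_op \<Phi> A g x) powr q * norm x powr \<gamma>) \<partial>lborel)
        \<le> ennreal (m powr q * ((\<Prod>i\<in>UNIV. c \<rho> \<kappa> i * N i) powr q * R powr ((\<beta> + n) * (l * q + 1))))"
    if R: "R > 0" for R
  proof -
    have "(\<integral>\<^sup>+x\<in>ball 0 R. ennreal (norm (hausdorff_op \<Phi> A g x) powr q * norm x powr \<gamma>) \<partial>lborel)
        \<le> (\<integral>\<^sup>+x. ennreal (enn2real (h x) powr q * w R x) \<partial>lborel)"
    proof (rule nn_integral_mono_AE, use fin in eventually_elim)
      fix x assume "h x < \<infinity>"
      then have fx: "(\<integral>\<^sup>+y. norm (hausdorff_integrand \<Phi> A g x y) \<partial>lborel) < \<infinity>"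
        by (simp add: h_def)
      have "norm (hausdorff_op \<Phi> A g x) \<le> enn2real (h x)"
        using norm_integral_le_nn_integral[of lebesgue "hausdorff_integrand \<Phi> A g x"] fx
        by (simp add: hausdorff_op_def h_def nn_integral_completion)
      then have "norm (hausdorff_op \<Phi> A g x) powr q \<le> enn2real (h x) powr q"
        using q by (intro powr_mono2) auto
      then show "ennreal (norm (hausdorff_op \<Phi> A g x) powr q * norm x powr \<gamma>) * indicator (ball 0 R) x
          \<le> ennreal (enn2real (h x) powr q * w R x)"
        by (auto simp: w_def indicator_def intro!: ennreal_leI mult_right_mono)
    qed
    also have "\<dots> \<le> ennreal (m powr q * D R)" by (rule Mink(2)[OF R])
    finally show ?thesis unfolding D_def .
  qed
qed

end

lemma borel_measurable_hausdorff_op: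
  fixes \<Phi> :: "real^'n \<Rightarrow> complex" and A :: "'m::finite \<Rightarrow> real^'n \<Rightarrow> real^'n^'n"
  assumes "\<Phi> \<in> borel_measurable borel"
    "\<And>i. A i \<in> borel_measurable borel" "\<And>i. g i \<in> borel_measurable borel"
  shows "hausdorff_op \<Phi> A g \<in> borel_measurable borel"
proof -
  note [measurable] = borel_measurable_hausdorff_integrand[OF assms]
  have "hausdorff_op \<Phi> A g = (\<lambda>x. LINT y|lborel. hausdorff_integrand \<Phi> A g x y)"
    unfolding hausdorff_op_def by (intro ext integral_completion) measurable
  also have "\<dots> \<in> borel_measurable lborel"
    by (rule lborel.borel_measurable_lebesgue_integral) measurable
  finally show ?thesis by simp
qed

section \<open>Passage between Lebesgue and Borel data\<close>

lemma ex_borel_measurable_AE_eq: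
  fixes f :: "'a::euclidean_space \<Rightarrow> 'b::euclidean_space"
  assumes [measurable]: "f \<in> borel_measurable lebesgue"
  obtains g where "g \<in> borel_measurable borel" "AE x in lborel. f x = g x"
proof -
  have "\<exists>g\<in>borel_measurable lborel. AE x in lborel. f x \<bullet> b = g x" for b
    by (intro completion_ex_borel_measurable_real) measurable
  then obtain g where g: "\<And>b. g b \<in> borel_measurable lborel" "\<And>b. AE x in lborel. f x \<bullet> b = g b x"
    by metis
  show thesis
  proof
    show "(\<lambda>x. \<Sum>b\<in>Basis. g b x *\<^sub>R b) \<in> borel_measurable borel"
      using g(1) by (intro borel_measurable_sum borel_measurable_scaleR) auto
    have "AE x in lborel. \<forall>b\<in>Basis. f x \<bullet> b = g b x"
      using g(2) by (intro AE_finite_allI) auto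
    then show "AE x in lborel. f x = (\<Sum>b\<in>Basis. g b x *\<^sub>R b)"
    proof eventually_elim
      fix x assume x: "\<forall>b\<in>Basis. f x \<bullet> b = g b x"
      have "f x = (\<Sum>b\<in>Basis. (f x \<bullet> b) *\<^sub>R b)" by (simp add: euclidean_representation)
      also have "\<dots> = (\<Sum>b\<in>Basis. g b x *\<^sub>R b)" using x by (intro sum.cong) auto
      finally show "f x = (\<Sum>b\<in>Basis. g b x *\<^sub>R b)" .
    qed
  qed
qed

text \<open>Completeness of Lebesgue measure: preimages under f differ from those under g within
  null sets.\<close>

lemma borel_measurable_lebesgue_AE_eq:
  fixes f g :: "'a::euclidean_space \<Rightarrow> 'b::topological_space"
  assumes g: "g \<in> borel_measurable borel" and eq: "AE x in lborel. f x = g x"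
  shows "f \<in> borel_measurable lebesgue"
proof (rule measurableI)
  fix S :: "'b set" assume "S \<in> sets borel"
  then have "g -` S \<in> sets lebesgue"
    using measurable_sets[OF measurable_completion[of g lborel borel]] g by simp
  moreover have "AE x in lebesgue. x \<in> g -` S \<longleftrightarrow> x \<in> f -` S"
    using AE_completion[OF eq] by eventually_elim auto
  ultimately show "f -` S \<inter> space lebesgue \<in> sets lebesgue"
    using completion.in_sets_AE[of "g -` S" "f -` S" lborel] by simp
qed simp

text \<open>Changing \<open>f i\<close> on a null set is harmless only if \<open>A' i y *v x\<close>
  avoids that set. At fixed y the linear substitution inequality shows that its preimage is null,
  and Tonelli exchanges the order of the two quantifiers.\<close>

lemma hausdorff_integrand_AE_eq:
  fixes \<Phi> :: "real^'n \<Rightarrow> complex" and A :: "'m::finite \<Rightarrow> real^'n \<Rightarrow> real^'n^'n"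
  assumes [measurable]: "\<And>i. A' i \<in> borel_measurable borel"
    and \<Phi>: "AE y in lborel. \<Phi> y = \<Phi>' y" and A: "\<And>i. AE y in lborel. A i y = A' i y"
    and f: "\<And>i. AE x in lborel. f i x = g i x"
    and conf: "AE y in lborel. \<forall>i. \<exists>e>0. \<forall>x. e * norm x \<le> norm (A' i y *v x)"
  shows "AE x in lborel. AE y in lborel. hausdorff_integrand \<Phi> A f x y = hausdorff_integrand \<Phi>' A' g x y"
proof -
  \<comment> \<open>The exceptional set is enclosed in a Borel null set, so that the condition on
    the pair (x, y) is measurable when the quantifiers are exchanged.\<close>
  have "\<exists>N. N \<in> null_sets lborel \<and> {x \<in> space lborel. f i x \<noteq> g i x} \<subseteq> N" for i
    using f[of i] unfolding eventually_ae_filter by auto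
  then obtain N where N: "\<And>i. N i \<in> null_sets lborel" "\<And>i. {x \<in> space lborel. f i x \<noteq> g i x} \<subseteq> N i"
    by metis
  have [measurable]: "N i \<in> sets borel" for i using N(1)[of i] by auto
  have "AE y in lborel. AE x in lborel. \<forall>i. A' i y *v x \<notin> N i"
    using conf
  proof eventually_elim
    fix y assume y: "\<forall>i. \<exists>e>0. \<forall>x. e * norm x \<le> norm (A' i y *v x)"
    have "AE x in lborel. A' i y *v x \<notin> N i" for i
    proof -
      obtain e where e: "e > 0" "\<And>x. e * norm x \<le> norm (A' i y *v x)" using y by blast
      have "(\<integral>\<^sup>+x. indicator (N i) (A' i y *v x) \<partial>lborel) \<le>
          ennreal ((1 / e) ^ DIM(real^'n)) * (\<integral>\<^sup>+x. indicator (N i) x \<partial>lborel)"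
        using e by (intro nn_integral_linear_comp_le) auto
      also have "\<dots> = 0" using N(1)[of i] by auto
      finally have "AE x in lborel. indicator (N i) (A' i y *v x) = (0::ennreal)"
        by (subst (asm) le_zero_eq, subst (asm) nn_integral_0_iff_AE) auto
      then show ?thesis by eventually_elim (auto simp: indicator_def split: if_splits)
    qed
    then have "AE x in lborel. \<forall>i\<in>UNIV. A' i y *v x \<notin> N i"
      by (intro AE_finite_allI) auto
    then show "AE x in lborel. \<forall>i. A' i y *v x \<notin> N i" by simp
  qed
  then have AE: "AE x in lborel. AE y in lborel. \<forall>i. A' i y *v x \<notin> N i"
    by (subst lborel_pair.AE_commute) measurable
  have Aeq: "AE y in lborel. \<forall>i. A i y = A' i y"
  proof -
    have "AE y in lborel. \<forall>i\<in>UNIV. A i y = A' i y"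
      using A by (intro AE_finite_allI) auto
    then show ?thesis by simp
  qed
  show ?thesis
  proof (rule eventually_mono[OF AE])
    fix x assume "AE y in lborel. \<forall>i. A' i y *v x \<notin> N i"
    then show "AE y in lborel. hausdorff_integrand \<Phi> A f x y = hausdorff_integrand \<Phi>' A' g x y"
      using \<Phi> Aeq
    proof eventually_elim
      fix y assume y: "\<forall>i. A' i y *v x \<notin> N i" "\<Phi> y = \<Phi>' y" "\<forall>i. A i y = A' i y"
      then have "f i (A i y *v x) = g i (A' i y *v x)" for i
        using N(2)[of i] by auto
      with y show "hausdorff_integrand \<Phi> A f x y = hausdorff_integrand \<Phi>' A' g x y"
        by (simp add: hausdorff_integrand_def)
    qed
  qed
qed

subsection \<open>Boundedness and the lower bound\<close>

text \<open>Turns the essential supremum into a pointwise condition. The maximum with 1 provides the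
  bound \<open>\<rho> \<ge> 1\<close> that the distortion estimates assume.\<close>

lemma admissible_kernel_AE_conformal:
  fixes \<Phi> :: "real^'n \<Rightarrow> complex" and A :: "'m::finite \<Rightarrow> real^'n \<Rightarrow> real^'n^'n"
  assumes adm: "admissible_kernel \<Phi> A" and rho: "rho A = ereal r"
  shows "AE y in lborel. \<forall>i. invertible (A i y) \<and> norm (A i y) * norm (matrix_inv (A i y)) \<le> max 1 r"
proof -
  have "AE y in lborel. \<forall>i\<in>UNIV. invertible (A i y)"
    using adm unfolding admissible_kernel_def AE_completion_iff by (intro AE_finite_allI) auto
  moreover have "AE y in lborel. (SUP i. ereal (norm (A i y) * norm (matrix_inv (A i y)))) \<le> ereal r"
    using esssup_AE[of "\<lambda>t. SUP i. ereal (norm (A i t) * norm (matrix_inv (A i t)))" lebesgue]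
    by (simp add: rho[unfolded rho_def] AE_completion_iff)
  ultimately show ?thesis
  proof eventually_elim
    fix y assume inv: "\<forall>i\<in>UNIV. invertible (A i y)"
      and le: "(SUP i. ereal (norm (A i y) * norm (matrix_inv (A i y)))) \<le> ereal r"
    have "ereal (norm (A i y) * norm (matrix_inv (A i y))) \<le> ereal r" for i
      by (rule order_trans[OF SUP_upper le]) simp
    then show "\<forall>i. invertible (A i y) \<and> norm (A i y) * norm (matrix_inv (A i y)) \<le> max 1 r"
      using inv by (auto simp: le_max_iff_disj)
  qed
qed

text \<open>\<open>norm A\<close> and \<open>1 / norm (matrix_inv A)\<close> are comparable within
  the factor \<open>\<rho>\<close>, hence so are their powers. This trades the factors of
  \<open>C1\<close> for those that substitutions produce.\<close>

lemma
  fixes A :: "real^'n^'n"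
  assumes inv: "invertible A" and \<rho>: "norm A * norm (matrix_inv A) \<le> \<rho>"
  shows norm_powr_le_matrix_inv: "norm A powr e \<le> \<rho> powr \<bar>e\<bar> * norm (matrix_inv A) powr - e"
    and matrix_inv_powr_le_norm: "norm (matrix_inv A) powr - e \<le> \<rho> powr \<bar>e\<bar> * norm A powr e"
proof -
  let ?b = "1 / norm (matrix_inv A)"
  note pos = norm_invertible_pos[OF inv \<rho>] norm_matrix_inv_pos[OF inv \<rho>]
  have le1: "norm A \<le> \<rho> * ?b" using pos \<rho> by (simp add: field_simps)
  have ge: "1 \<le> norm A * norm (matrix_inv A)" by (rule norm_matrix_inv_ge[OF inv \<rho>])
  then have "1 \<le> \<rho>" using \<rho> by linarith
  then have "1 * 1 \<le> \<rho> * (norm A * norm (matrix_inv A))" using ge by (intro mult_mono) auto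
  then have le2: "?b \<le> \<rho> * norm A" using pos by (simp add: field_simps)
  have b: "?b powr e = norm (matrix_inv A) powr - e"
    using pos by (simp add: powr_divide powr_minus field_simps)
  show "norm A powr e \<le> \<rho> powr \<bar>e\<bar> * norm (matrix_inv A) powr - e"
    using powr_le_of_ratio_le[of "norm A" ?b \<rho> e] pos le1 le2 unfolding b by simp
  show "norm (matrix_inv A) powr - e \<le> \<rho> powr \<bar>e\<bar> * norm A powr e"
    using powr_le_of_ratio_le[of ?b "norm A" \<rho> e] pos le1 le2 unfolding b by simp
qed

section \<open>Comparison of the operator norm with C1\<close>

context morrey_exponents
begin

lemma C1_eq:
  fixes \<Phi> :: "real^'n \<Rightarrow> complex" and A :: "'m \<Rightarrow> real^'n \<Rightarrow> real^'n^'n"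
  assumes "n = real CARD('n)"
  shows "C1 \<Phi> A \<beta>s \<gamma>s qs ls = (\<integral>\<^sup>+ y. ennreal (norm (\<Phi> y) / norm y ^ CARD('n) *
    (\<Prod>i\<in>UNIV. norm (matrix_inv (A i y)) powr - s i)) \<partial>lborel)"
proof -
  have "- (\<beta>s i + n) * ls i + (\<gamma>s i - \<beta>s i) * (1 / qs i) = - s i" for i
    by (simp add: s_def diff_divide_distrib algebra_simps)
  then show ?thesis unfolding C1_def assms nn_integral_completion by simp
qed

text \<open>The total loss when each \<open>norm (matrix_inv (A i y)) powr - s i\<close> is
  exchanged for \<open>norm (A i y) powr s i\<close>, in either direction.\<close>

definition distortion :: "real \<Rightarrow> real"
  where "distortion \<rho> = (\<Prod>i\<in>UNIV. \<rho> powr \<bar>s i\<bar>)"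

lemma distortion_pos: "\<rho> \<ge> 1 \<Longrightarrow> distortion \<rho> > 0"
  unfolding distortion_def by (intro prod_pos) auto

lemma nn_integral_kernel_le_C1:
  fixes \<Phi> :: "real^'n \<Rightarrow> complex" and A :: "'m \<Rightarrow> real^'n \<Rightarrow> real^'n^'n"
  assumes dim: "n = real CARD('n)"
    and adm: "admissible_kernel \<Phi> A" and rho: "rho A = ereal r" and fin: "C1 \<Phi> A \<beta>s \<gamma>s qs ls < \<infinity>"
    and [measurable]: "\<Phi>' \<in> borel_measurable borel" "\<And>i. A' i \<in> borel_measurable borel"
    and \<Phi>': "AE y in lborel. \<Phi> y = \<Phi>' y" and A': "AE y in lborel. \<forall>i. A i y = A' i y"
  shows "(\<integral>\<^sup>+y. ennreal (norm (\<Phi>' y) / norm y ^ CARD('n) * (\<Prod>i\<in>UNIV. norm (A' i y) powr s i)) \<partial>lborel)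
    \<le> ennreal (distortion (max 1 r) * enn2real (C1 \<Phi> A \<beta>s \<gamma>s qs ls))"
proof -
  define L where "L = distortion (max 1 r)"
  have L: "L > 0" unfolding L_def by (intro distortion_pos) simp
  define k where "k y = norm (\<Phi>' y) / norm y ^ CARD('n) * (\<Prod>i\<in>UNIV. norm (A' i y) powr s i)" for y
  have [measurable]: "k \<in> borel_measurable borel"
    unfolding k_def[abs_def] by measurable
  \<comment> \<open>The constant is kept beside the Borel function \<open>k\<close>, where it may
    leave the integral; measurability of the integrand of \<open>C1\<close> never enters.\<close>
  have "(\<integral>\<^sup>+y. ennreal (1 / L) * ennreal (k y) \<partial>lborel) \<le> C1 \<Phi> A \<beta>s \<gamma>s qs ls"
    unfolding C1_eq[OF dim]
  proof (rule nn_integral_mono_AE, use admissible_kernel_AE_conformal[OF adm rho] \<Phi>' A' in eventually_elim)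
    fix y
    assume inv: "\<forall>i. invertible (A i y) \<and> norm (A i y) * norm (matrix_inv (A i y)) \<le> max 1 r"
      and eq: "\<Phi> y = \<Phi>' y" "\<forall>i. A i y = A' i y"
    have "(\<Prod>i\<in>UNIV. norm (A' i y) powr s i) \<le>
        (\<Prod>i\<in>UNIV. max 1 r powr \<bar>s i\<bar> * norm (matrix_inv (A i y)) powr - s i)"
      using inv eq by (intro prod_mono) (auto intro!: norm_powr_le_matrix_inv)
    also have "\<dots> = L * (\<Prod>i\<in>UNIV. norm (matrix_inv (A i y)) powr - s i)"
      by (simp add: prod.distrib L_def distortion_def)
    finally have "k y \<le> norm (\<Phi>' y) / norm y ^ CARD('n) * (L * (\<Prod>i\<in>UNIV. norm (matrix_inv (A i y)) powr - s i))"
      unfolding k_def by (intro mult_left_mono) auto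
    then have "1 / L * k y \<le> norm (\<Phi> y) / norm y ^ CARD('n) * (\<Prod>i\<in>UNIV. norm (matrix_inv (A i y)) powr - s i)"
      using L eq by (simp add: field_simps)
    then show "ennreal (1 / L) * ennreal (k y) \<le>
        ennreal (norm (\<Phi> y) / norm y ^ CARD('n) * (\<Prod>i\<in>UNIV. norm (matrix_inv (A i y)) powr - s i))"
      using L by (subst ennreal_mult'[symmetric]) (auto intro: ennreal_leI)
  qed
  then have le: "ennreal (1 / L) * (\<integral>\<^sup>+y. ennreal (k y) \<partial>lborel) \<le> C1 \<Phi> A \<beta>s \<gamma>s qs ls"
    by (simp add: nn_integral_cmult)
  have "(\<integral>\<^sup>+y. ennreal (k y) \<partial>lborel) = ennreal L * (ennreal (1 / L) * (\<integral>\<^sup>+y. ennreal (k y) \<partial>lborel))"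
    using L by (simp add: mult.assoc[symmetric] ennreal_mult[symmetric])
  also have "\<dots> \<le> ennreal L * C1 \<Phi> A \<beta>s \<gamma>s qs ls"
    using le by (intro mult_left_mono) auto
  also have "\<dots> = ennreal (L * enn2real (C1 \<Phi> A \<beta>s \<gamma>s qs ls))"
    using fin L by (simp add: ennreal_mult less_top)
  finally show ?thesis unfolding k_def L_def .
qed

text \<open>In \<open>K\<close>, the distortion comes from comparing the kernel with
  \<open>C1\<close>, the product of the \<open>c\<close> from Hoelder, and the power of
  \<open>\<kappa>0\<close> from normalising by the mass in the target space.\<close>

lemma hausdorff_op_bound:
  fixes \<Phi> :: "real^'n \<Rightarrow> complex" and A :: "'m \<Rightarrow> real^'n \<Rightarrow> real^'n^'n"
  assumes dim: "n = real CARD('n)"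
    and adm: "admissible_kernel \<Phi> A" and rho: "rho A = ereal r" and fin: "C1 \<Phi> A \<beta>s \<gamma>s qs ls < \<infinity>"
    and f: "\<And>i. f i \<in> morrey_space (power_weight (\<beta>s i)) (power_weight (\<gamma>s i)) (qs i) (ls i)"
  defines "\<kappa> \<equiv> \<lambda>i. weight_mass (power_weight (\<beta>s i)) (ball (0::real^'n) 1)"
    and "\<kappa>0 \<equiv> weight_mass (power_weight \<beta>) (ball (0::real^'n) 1)"
  defines "K \<equiv> distortion (max 1 r) * (\<Prod>i\<in>UNIV. c (max 1 r) \<kappa> i) * \<kappa>0 powr - (l + 1 / q)"
  shows "hausdorff_well_defined \<Phi> A f"
    and "hausdorff_op \<Phi> A f \<in> morrey_space (power_weight \<beta>) (power_weight \<gamma>) q l"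
    and "morrey_norm (power_weight \<beta>) (power_weight \<gamma>) q l (hausdorff_op \<Phi> A f) \<le>
      K * enn2real (C1 \<Phi> A \<beta>s \<gamma>s qs ls) *
      (\<Prod>i\<in>UNIV. morrey_norm (power_weight (\<beta>s i)) (power_weight (\<gamma>s i)) (qs i) (ls i) (f i))"
proof -
  define \<rho> where "\<rho> = max 1 r"
  have \<rho>: "\<rho> \<ge> 1" by (simp add: \<rho>_def)
  define m where "m = distortion \<rho> * enn2real (C1 \<Phi> A \<beta>s \<gamma>s qs ls)"
  have m: "m \<ge> 0" using distortion_pos[OF \<rho>] by (simp add: m_def)
  define N where "N i = morrey_norm (power_weight (\<beta>s i)) (power_weight (\<gamma>s i)) (qs i) (ls i) (f i)" for i
  have qs0: "qs i > 0" for i using qs[of i] by simp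
  have q0: "q > 0" using q by simp
  have dims: "- real DIM(real^'n) < \<beta>s i" "- real DIM(real^'n) < \<beta>" for i
    using \<beta>s[of i] \<beta> dim by auto
  have mass: "weight_mass (power_weight (\<beta>s i)) (ball (0::real^'n) R) = R powr (\<beta>s i + n) * \<kappa> i"
    "weight_mass (power_weight \<beta>) (ball (0::real^'n) R) = R powr (\<beta> + n) * \<kappa>0" if "R > 0" for i R
    using weight_mass_power_weight_ball[OF dims(1) that] weight_mass_power_weight_ball[OF dims(2) that] dim
    by (simp_all add: \<kappa>_def \<kappa>0_def)
  have \<kappa>: "\<kappa> i > 0" "\<kappa>0 > 0" for i
    using weight_mass_power_weight_pos[OF dims(1)] weight_mass_power_weight_pos[OF dims(2)]
    by (auto simp: \<kappa>_def \<kappa>0_def)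
  have mass_pos: "weight_mass (power_weight (\<beta>s i)) (ball (0::real^'n) R) > 0"
    "weight_mass (power_weight \<beta>) (ball (0::real^'n) R) > 0" if "R > 0" for i R
    using \<kappa> that by (auto simp: mass)
  note fD = morrey_spaceD[OF f mass_pos(1) qs0, folded N_def]
  have c0: "c \<rho> \<kappa> i \<ge> 0" for i by (simp add: c_def)

  have "\<exists>g. g \<in> borel_measurable borel \<and> (AE x in lborel. f i x = g x)" for i
    by (rule ex_borel_measurable_AE_eq[OF fD(1)]) blast+
  then obtain g where g: "\<And>i. g i \<in> borel_measurable borel" "\<And>i. AE x in lborel. f i x = g i x"
    by metis
  have "\<exists>B. B \<in> borel_measurable borel \<and> (AE y in lborel. A i y = B y)" for i
  proof -
    have "A i \<in> borel_measurable lebesgue" using adm by (simp add: admissible_kernel_def)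
    then show ?thesis by (rule ex_borel_measurable_AE_eq) blast
  qed
  then obtain B where B: "\<And>i. B i \<in> borel_measurable borel" "\<And>i. AE y in lborel. A i y = B i y"
    by metis
  have "AE y in lborel. \<forall>i\<in>UNIV. A i y = B i y"
    using B(2) by (intro AE_finite_allI) auto
  then have AB: "AE y in lborel. \<forall>i. A i y = B i y" by simp
  \<comment> \<open>Local integrability gives measurability of the truncations to balls only;
    \<open>\<Phi>\<close> is their pointwise limit.\<close>
  have "\<Phi> \<in> borel_measurable lebesgue"
  proof -
    have "\<And>R. set_integrable lebesgue (cball 0 R) \<Phi>"
      using adm by (simp add: admissible_kernel_def locally_integrable_def)
    then have "\<And>j::nat. (\<lambda>x. indicator (cball 0 (real j)) x *\<^sub>R \<Phi> x) \<in> borel_measurable lebesgue"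
      unfolding set_integrable_def by auto
    moreover have "(\<lambda>j. indicator (cball 0 (real j)) x *\<^sub>R \<Phi> x) \<longlonglongrightarrow> \<Phi> x" for x
    proof (rule tendsto_eventually)
      obtain j0 :: nat where "norm x \<le> real j0" using real_arch_simple by blast
      then show "\<forall>\<^sub>F j in sequentially. indicator (cball 0 (real j)) x *\<^sub>R \<Phi> x = \<Phi> x"
        by (intro eventually_sequentiallyI[of j0]) (auto simp: indicator_def)
    qed
    ultimately show ?thesis
      by (rule borel_measurable_LIMSEQ_metric)
  qed
  then obtain \<Psi> where \<Psi>: "\<Psi> \<in> borel_measurable borel" "AE y in lborel. \<Phi> y = \<Psi> y"
    by (rule ex_borel_measurable_AE_eq)

  have conf: "AE y in lborel. \<forall>i. norm (B i y) > 0 \<and> (\<forall>x. norm (B i y) / \<rho> * norm x \<le> norm (B i y *v x))"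
    using admissible_kernel_AE_conformal[OF adm rho] AB
  proof eventually_elim
    fix y
    assume "\<forall>i. invertible (A i y) \<and> norm (A i y) * norm (matrix_inv (A i y)) \<le> max 1 r" "\<forall>i. A i y = B i y"
    then show "\<forall>i. norm (B i y) > 0 \<and> (\<forall>x. norm (B i y) / \<rho> * norm x \<le> norm (B i y *v x))"
      unfolding \<rho>_def using norm_invertible_pos[of "A _ y" "max 1 r"] norm_matrix_vector_mult_ge[of "A _ y" "max 1 r"]
      by simp
  qed
  then have conf': "AE y in lborel. \<forall>i. \<exists>e>0. \<forall>x. e * norm x \<le> norm (B i y *v x)"
  proof eventually_elim
    fix y assume y: "\<forall>i. norm (B i y) > 0 \<and> (\<forall>x. norm (B i y) / \<rho> * norm x \<le> norm (B i y *v x))"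
    show "\<forall>i. \<exists>e>0. \<forall>x. e * norm x \<le> norm (B i y *v x)"
    proof
      fix i show "\<exists>e>0. \<forall>x. e * norm x \<le> norm (B i y *v x)"
        using y \<rho> by (intro exI[of _ "norm (B i y) / \<rho>"]) auto
    qed
  qed
  have gle: "(\<integral>\<^sup>+x\<in>ball 0 R. ennreal (norm (g i x) powr qs i * norm x powr \<gamma>s i) \<partial>lborel)
      \<le> ennreal (N i powr qs i * (R powr (\<beta>s i + n) * \<kappa> i) powr (ls i * qs i + 1))" if "R > 0" for i R
  proof -
    have "(\<integral>\<^sup>+x\<in>ball 0 R. ennreal (norm (g i x) powr qs i * norm x powr \<gamma>s i) \<partial>lborel) =
        (\<integral>\<^sup>+x\<in>ball 0 R. ennreal (norm (f i x) powr qs i * norm x powr \<gamma>s i) \<partial>lborel)"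
      using g(2)[of i] by (intro nn_integral_cong_AE) (auto elim!: eventually_mono)
    also note fD(5)[OF _ that]
    finally show ?thesis using that by (simp add: mass)
  qed
  have kle: "(\<integral>\<^sup>+y. ennreal (norm (\<Psi> y) / norm y ^ CARD('n) * (\<Prod>i\<in>UNIV. norm (B i y) powr s i)) \<partial>lborel) \<le> ennreal m"
    unfolding m_def \<rho>_def by (rule nn_integral_kernel_le_C1[OF dim adm rho fin \<Psi>(1) B(1) \<Psi>(2) AB])
  have N0: "N i \<ge> 0" for i using fD(2) mass_pos by blast
  have finite_g: "AE x in lborel. (\<integral>\<^sup>+y. norm (hausdorff_integrand \<Psi> B g x y) \<partial>lborel) < \<infinity>"
    by (rule AE_nn_integral_hausdorff_integrand_finite[OF dim \<Psi>(1) B(1) g(1) \<rho> conf m kle N0 \<kappa>(1) gle])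
  have op_g: "(\<integral>\<^sup>+x\<in>ball 0 R. ennreal (norm (hausdorff_op \<Psi> B g x) powr q * norm x powr \<gamma>) \<partial>lborel)
      \<le> ennreal (m powr q * ((\<Prod>i\<in>UNIV. c \<rho> \<kappa> i * N i) powr q * R powr ((\<beta> + n) * (l * q + 1))))"
    if "R > 0" for R
    by (rule nn_integral_hausdorff_op_le[OF dim \<Psi>(1) B(1) g(1) \<rho> conf m kle N0 \<kappa>(1) gle that])
  have eq: "AE x in lborel. AE y in lborel. hausdorff_integrand \<Phi> A f x y = hausdorff_integrand \<Psi> B g x y"
    by (rule hausdorff_integrand_AE_eq[OF B(1) \<Psi>(2) B(2) g(2) conf'])
  have meas: "hausdorff_integrand \<Psi> B g x \<in> borel_measurable borel" for x
    using measurable_Pair2[OF borel_measurable_hausdorff_integrand[OF \<Psi>(1) B(1) g(1)], of x] by simp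
  \<comment> \<open>Agreement for almost every y transfers measurability, integrability and the
    value of the integral from the Borel data to the given ones.\<close>
  have both: "AE x in lborel. integrable lebesgue (hausdorff_integrand \<Phi> A f x) \<and>
      hausdorff_op \<Phi> A f x = hausdorff_op \<Psi> B g x"
    using eq finite_g
  proof eventually_elim
    fix x
    assume x: "AE y in lborel. hausdorff_integrand \<Phi> A f x y = hausdorff_integrand \<Psi> B g x y"
      and fin: "(\<integral>\<^sup>+y. norm (hausdorff_integrand \<Psi> B g x y) \<partial>lborel) < \<infinity>"
    have 1: "hausdorff_integrand \<Phi> A f x \<in> borel_measurable lebesgue"
      by (rule borel_measurable_lebesgue_AE_eq[OF meas x])
    have 2: "hausdorff_integrand \<Psi> B g x \<in> borel_measurable lebesgue"
      using meas by (intro measurable_completion) simp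
    have 3: "AE y in lebesgue. hausdorff_integrand \<Phi> A f x y = hausdorff_integrand \<Psi> B g x y"
      using x by (rule AE_completion)
    have "integrable lebesgue (hausdorff_integrand \<Psi> B g x)"
      using 2 fin by (intro integrableI_bounded) (auto simp: nn_integral_completion)
    then show "integrable lebesgue (hausdorff_integrand \<Phi> A f x) \<and>
      hausdorff_op \<Phi> A f x = hausdorff_op \<Psi> B g x"
      unfolding hausdorff_op_def using integrable_cong_AE[OF 1 2 3] integral_cong_AE[OF 1 2 3] by simp
  qed
  then show "hausdorff_well_defined \<Phi> A f"
    unfolding hausdorff_well_defined_def AE_completion_iff by (auto elim: eventually_mono)
  have opeq: "AE x in lborel. hausdorff_op \<Phi> A f x = hausdorff_op \<Psi> B g x"
    using both by (auto elim: eventually_mono)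
  have measH: "hausdorff_op \<Phi> A f \<in> borel_measurable lebesgue"
    by (rule borel_measurable_lebesgue_AE_eq[OF borel_measurable_hausdorff_op[OF \<Psi>(1) B(1) g(1)] opeq])
  \<comment> \<open>The negative power of \<open>\<kappa>0\<close> is chosen to cancel
    \<open>\<kappa>0 powr (l * q + 1)\<close>, which enters through the mass of the ball.\<close>
  define M where "M = m * (\<Prod>i\<in>UNIV. c \<rho> \<kappa> i * N i) * \<kappa>0 powr - (l + 1 / q)"
  have P0: "(\<Prod>i\<in>UNIV. c \<rho> \<kappa> i * N i) \<ge> 0" using c0 N0 by (intro prod_nonneg) auto
  have M: "M \<ge> 0" using m P0 by (simp add: M_def)
  have H: "(\<integral>\<^sup>+x\<in>ball 0 R. ennreal (norm (hausdorff_op \<Phi> A f x) powr q * norm x powr \<gamma>) \<partial>lborel)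
      \<le> ennreal (M powr q * weight_mass (power_weight \<beta>) (ball (0::real^'n) R) powr (l * q + 1))" if "R > 0" for R
  proof -
    have "(\<integral>\<^sup>+x\<in>ball 0 R. ennreal (norm (hausdorff_op \<Phi> A f x) powr q * norm x powr \<gamma>) \<partial>lborel) =
        (\<integral>\<^sup>+x\<in>ball 0 R. ennreal (norm (hausdorff_op \<Psi> B g x) powr q * norm x powr \<gamma>) \<partial>lborel)"
      using opeq by (intro nn_integral_cong_AE) (auto elim!: eventually_mono)
    also have "\<dots> \<le> ennreal (m powr q * ((\<Prod>i\<in>UNIV. c \<rho> \<kappa> i * N i) powr q * R powr ((\<beta> + n) * (l * q + 1))))"
      by (rule op_g[OF that])
    also have "m powr q * ((\<Prod>i\<in>UNIV. c \<rho> \<kappa> i * N i) powr q * R powr ((\<beta> + n) * (l * q + 1))) =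
        M powr q * (R powr (\<beta> + n) * \<kappa>0) powr (l * q + 1)"
    proof -
      have "- (l + 1 / q) * q = - (l * q + 1)" using q0 by (simp add: field_simps)
      then have "M powr q = m powr q * (\<Prod>i\<in>UNIV. c \<rho> \<kappa> i * N i) powr q * \<kappa>0 powr - (l * q + 1)"
        by (simp only: M_def powr_mult powr_powr)
      moreover have "\<kappa>0 powr - (l * q + 1) * \<kappa>0 powr (l * q + 1) = 1"
        using \<kappa>(2) by (simp add: powr_add[symmetric])
      ultimately show ?thesis by (simp add: powr_mult powr_powr)
    qed
    finally show ?thesis using that by (simp add: mass)
  qed
  show "hausdorff_op \<Phi> A f \<in> morrey_space (power_weight \<beta>) (power_weight \<gamma>) q l"
    by (rule morrey_spaceI(1)[OF measH mass_pos(2) q0 M H])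
  have "morrey_norm (power_weight \<beta>) (power_weight \<gamma>) q l (hausdorff_op \<Phi> A f) \<le> M"
    by (rule morrey_spaceI(2)[OF measH mass_pos(2) q0 M H])
  also have "M = K * enn2real (C1 \<Phi> A \<beta>s \<gamma>s qs ls) * (\<Prod>i\<in>UNIV. N i)"
    by (simp add: M_def K_def m_def \<rho>_def prod.distrib)
  finally show "morrey_norm (power_weight \<beta>) (power_weight \<gamma>) q l (hausdorff_op \<Phi> A f) \<le>
      K * enn2real (C1 \<Phi> A \<beta>s \<gamma>s qs ls) *
      (\<Prod>i\<in>UNIV. morrey_norm (power_weight (\<beta>s i)) (power_weight (\<gamma>s i)) (qs i) (ls i) (f i))"
    unfolding N_def .
qed


text \<open>A constant sign rules out cancellation in the integral. The distortion is squared
  because two exchanges are made: the norm of the inverse for \<open>norm (A i y)\<close>, and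
  \<open>norm (A i y) * norm x\<close> for \<open>norm (A i y *v x)\<close>.\<close>

lemma C1_le_hausdorff_power:
  fixes \<Phi> :: "real^'n \<Rightarrow> complex" and A :: "'m \<Rightarrow> real^'n \<Rightarrow> real^'n^'n"
  assumes dim: "n = real CARD('n)"
    and adm: "admissible_kernel \<Phi> A" and rho: "rho A = ereal r"
    and sign: "real_of_constant_sign \<Phi>" and x: "x \<noteq> 0"
  defines "f \<equiv> \<lambda>i (z::real^'n). complex_of_real (norm z powr s i)"
  assumes int: "integrable lebesgue (hausdorff_integrand \<Phi> A f x)"
  shows "C1 \<Phi> A \<beta>s \<gamma>s qs ls \<le>
    ennreal ((distortion (max 1 r))\<^sup>2 * norm x powr - (\<Sum>i\<in>UNIV. s i) * norm (hausdorff_op \<Phi> A f x))"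
proof -
  define \<rho> where "\<rho> = max 1 r"
  have \<rho>: "\<rho> \<ge> 1" by (simp add: \<rho>_def)
  define L where "L = distortion \<rho>"
  have L: "L > 0" unfolding L_def by (rule distortion_pos[OF \<rho>])
  define S where "S = (\<Sum>i\<in>UNIV. s i)"
  define u where "u y = norm (hausdorff_integrand \<Phi> A f x y)" for y
  have u: "integrable lebesgue u" unfolding u_def using int by (rule integrable_norm)
  have u_eq: "u y = norm (\<Phi> y) / norm y ^ CARD('n) * (\<Prod>i\<in>UNIV. norm (A i y *v x) powr s i)" for y
    by (simp add: u_def f_def hausdorff_integrand_def norm_mult norm_divide norm_power prod_norm[symmetric])
  have "norm (hausdorff_op \<Phi> A f x) = (LINT y|lebesgue. u y)"
  proof -
    \<comment> \<open>The common sign of \<open>\<Phi>\<close>; the test functions are nonnegative,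
      so it is the sign of the whole integrand and can be pulled out.\<close>
    obtain \<epsilon> :: real where \<epsilon>: "\<bar>\<epsilon>\<bar> = 1" "\<And>y. \<Phi> y = complex_of_real (\<epsilon> * norm (\<Phi> y))"
    proof -
      from sign have R: "\<And>y. \<Phi> y \<in> \<real>" and "(\<forall>y. 0 \<le> Re (\<Phi> y)) \<or> (\<forall>y. Re (\<Phi> y) \<le> 0)"
        by (auto simp: real_of_constant_sign_def)
      then consider "\<And>y. 0 \<le> Re (\<Phi> y)" | "\<And>y. Re (\<Phi> y) \<le> 0" by blast
      then show thesis
      proof cases
        case 1
        then show ?thesis using R by (intro that[of 1]) (auto simp: complex_is_Real_iff complex_eq_iff cmod_eq_Re)
      next
        case 2
        then show ?thesis using R by (intro that[of "-1"]) (auto simp: complex_is_Real_iff complex_eq_iff cmod_eq_Re)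
      qed
    qed
    have "hausdorff_integrand \<Phi> A f x y = complex_of_real (\<epsilon> * u y)" for y
      unfolding hausdorff_integrand_def u_eq f_def by (subst \<epsilon>(2)) (simp add: of_real_prod)
    then have "hausdorff_op \<Phi> A f x = complex_of_real (\<epsilon> * (LINT y|lebesgue. u y))"
      by (simp add: hausdorff_op_def)
    moreover have "0 \<le> (LINT y|lebesgue. u y)"
      by (intro integral_nonneg_AE) (auto simp: u_def)
    ultimately show ?thesis using \<epsilon>(1) by (simp add: abs_mult norm_mult)
  qed
  then have nn: "(\<integral>\<^sup>+y. ennreal (u y) \<partial>lebesgue) = ennreal (norm (hausdorff_op \<Phi> A f x))"
    by (subst nn_integral_eq_integral[OF u]) (simp_all add: u_def[abs_def])
  have "C1 \<Phi> A \<beta>s \<gamma>s qs ls \<le> (\<integral>\<^sup>+y. ennreal (L\<^sup>2 * norm x powr - S) * ennreal (u y) \<partial>lebesgue)"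
    unfolding C1_eq[OF dim] nn_integral_completion
  proof (rule nn_integral_mono_AE, use admissible_kernel_AE_conformal[OF adm rho] in eventually_elim)
    fix y
    assume inv: "\<forall>i. invertible (A i y) \<and> norm (A i y) * norm (matrix_inv (A i y)) \<le> max 1 r"
    have "norm (matrix_inv (A i y)) powr - s i \<le>
        \<rho> powr \<bar>s i\<bar> * \<rho> powr \<bar>s i\<bar> * (norm x powr - s i * norm (A i y *v x) powr s i)" for i
    proof -
      have A: "invertible (A i y)" "norm (A i y) * norm (matrix_inv (A i y)) \<le> \<rho>"
        using inv by (auto simp: \<rho>_def)
      have a: "norm (A i y) > 0" by (rule norm_invertible_pos[OF A])
      have low: "norm (A i y) / \<rho> * norm x \<le> norm (A i y *v x)"
        by (rule norm_matrix_vector_mult_ge[OF A])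
      have pos: "norm (A i y *v x) > 0"
        using a \<rho> x by (intro order.strict_trans2[OF _ low]) simp
      have "1 * norm (A i y *v x) \<le> \<rho> * (norm (A i y) * norm x)"
        using \<rho> norm_matrix_vector_mult_le[of "A i y" x] by (intro mult_mono) auto
      then have "(norm (A i y) * norm x) powr s i \<le> \<rho> powr \<bar>s i\<bar> * norm (A i y *v x) powr s i"
        using low \<rho> a x pos by (intro powr_le_of_ratio_le) (auto simp: field_simps)
      then have "norm (A i y) powr s i \<le> \<rho> powr \<bar>s i\<bar> * (norm x powr - s i * norm (A i y *v x) powr s i)"
        using x by (simp add: powr_mult powr_minus field_simps)
      then have "\<rho> powr \<bar>s i\<bar> * norm (A i y) powr s i \<le>
          \<rho> powr \<bar>s i\<bar> * (\<rho> powr \<bar>s i\<bar> * (norm x powr - s i * norm (A i y *v x) powr s i))"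
        by (intro mult_left_mono) auto
      with matrix_inv_powr_le_norm[OF A, of "s i"] show ?thesis by (simp add: mult.assoc)
    qed
    then have "(\<Prod>i\<in>UNIV. norm (matrix_inv (A i y)) powr - s i) \<le>
        (\<Prod>i\<in>UNIV. \<rho> powr \<bar>s i\<bar> * \<rho> powr \<bar>s i\<bar> * (norm x powr - s i * norm (A i y *v x) powr s i))"
      by (intro prod_mono) auto
    also have "\<dots> = L\<^sup>2 * (norm x powr - S * (\<Prod>i\<in>UNIV. norm (A i y *v x) powr s i))"
      using x by (simp add: prod.distrib L_def distortion_def power2_eq_square S_def powr_sum sum_negf[symmetric])
    finally have "norm (\<Phi> y) / norm y ^ CARD('n) * (\<Prod>i\<in>UNIV. norm (matrix_inv (A i y)) powr - s i) \<le>
        norm (\<Phi> y) / norm y ^ CARD('n) * (L\<^sup>2 * (norm x powr - S * (\<Prod>i\<in>UNIV. norm (A i y *v x) powr s i)))"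
      by (intro mult_left_mono) auto
    also have "\<dots> = (L\<^sup>2 * norm x powr - S) * u y"
      by (simp add: u_eq)
    finally have "ennreal (norm (\<Phi> y) / norm y ^ CARD('n) * (\<Prod>i\<in>UNIV. norm (matrix_inv (A i y)) powr - s i))
        \<le> ennreal ((L\<^sup>2 * norm x powr - S) * u y)"
      by (rule ennreal_leI)
    then show "ennreal (norm (\<Phi> y) / norm y ^ CARD('n) * (\<Prod>i\<in>UNIV. norm (matrix_inv (A i y)) powr - s i))
        \<le> ennreal (L\<^sup>2 * norm x powr - S) * ennreal (u y)"
      by (subst (asm) ennreal_mult') auto
  qed
  also have "\<dots> = ennreal (L\<^sup>2 * norm x powr - S) * ennreal (norm (hausdorff_op \<Phi> A f x))"
    using u by (subst nn_integral_cmult) (auto simp: nn)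
  also have "\<dots> = ennreal (L\<^sup>2 * norm x powr - S * norm (hausdorff_op \<Phi> A f x))"
    by (simp add: ennreal_mult'')
  finally show ?thesis by (simp add: L_def S_def \<rho>_def)
qed

text \<open>At the critical degree, numerator and denominator of the Morrey quotient scale with the
  same power of R, so the quotient is constant.\<close>

lemma powr_in_morrey_space:
  fixes \<beta>' \<gamma>' q' l' :: real
  assumes "\<beta>' > - real DIM('a::euclidean_space)" "q' > 0" "1 + l' * q' > 0"
    and "e = (\<beta>' + DIM('a)) * l' + (\<beta>' - \<gamma>') / q'"
  defines "f \<equiv> \<lambda>z::'a. complex_of_real (norm z powr e)"
  shows "\<exists>N>0. f \<in> morrey_space (power_weight \<beta>') (power_weight \<gamma>') q' l' \<and>
    morrey_norm (power_weight \<beta>') (power_weight \<gamma>') q' l' f \<le> N"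
proof -
  \<comment> \<open>The degree of \<open>norm (f x) powr q'\<close> times the weight;
    \<open>1 + l' * q' > 0\<close> is what puts it above minus the dimension, making it integrable
    at the origin.\<close>
  define b where "b = e * q' + \<gamma>'"
  have b: "b + DIM('a) = (\<beta>' + DIM('a)) * (l' * q' + 1)"
    using assms(2) by (simp add: b_def assms(4) field_simps)
  have "(\<beta>' + DIM('a)) * (l' * q' + 1) > 0" using assms by (intro mult_pos_pos) auto
  then have bn: "b > - real DIM('a)" using b by linarith
  define \<kappa> where "\<kappa> = weight_mass (power_weight \<beta>') (ball (0::'a) 1)"
  define \<mu> where "\<mu> = weight_mass (power_weight b) (ball (0::'a) 1)"
  have pos: "\<kappa> > 0" "\<mu> > 0"
    using weight_mass_power_weight_pos[OF assms(1)] weight_mass_power_weight_pos[OF bn] by (auto simp: \<kappa>_def \<mu>_def)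
  \<comment> \<open>The constant value of the quotient, computed at R = 1.\<close>
  define N where "N = (\<mu> * \<kappa> powr - (l' * q' + 1)) powr (1 / q')"
  have N: "N > 0" using pos by (simp add: N_def)
  have mass: "weight_mass (power_weight \<beta>') (ball (0::'a) R) = R powr (\<beta>' + DIM('a)) * \<kappa>" if "R > 0" for R
    using weight_mass_power_weight_ball[OF assms(1) that] by (simp add: \<kappa>_def)
  have mass_pos: "weight_mass (power_weight \<beta>') (ball (0::'a) R) > 0" if "R > 0" for R
    using that pos by (simp add: mass)
  have meas: "f \<in> borel_measurable lebesgue"
    unfolding f_def by (intro measurable_completion) measurable
  have le: "(\<integral>\<^sup>+x\<in>ball 0 R. ennreal (norm (f x) powr q' * norm x powr \<gamma>') \<partial>lborel)
      \<le> ennreal (N powr q' * weight_mass (power_weight \<beta>') (ball (0::'a) R) powr (l' * q' + 1))" if R: "R > 0" for R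
  proof -
    have "(\<integral>\<^sup>+x\<in>ball 0 R. ennreal (norm (f x) powr q' * norm x powr \<gamma>') \<partial>lborel) =
        (\<integral>\<^sup>+x\<in>ball (0::'a) R. ennreal (norm x powr b) \<partial>lborel)"
      by (intro nn_integral_cong) (simp add: f_def b_def powr_powr powr_add)
    also have "\<dots> = ennreal (R powr (b + DIM('a)) * \<mu>)"
      using ennreal_weight_mass_power_weight[OF bn R] by (simp add: \<mu>_def)
    also have "R powr (b + DIM('a)) * \<mu> = N powr q' * (R powr (\<beta>' + DIM('a)) * \<kappa>) powr (l' * q' + 1)"
    proof -
      have "N powr q' = \<mu> * \<kappa> powr - (l' * q' + 1)"
        using assms(2) pos by (simp add: N_def powr_powr)
      moreover have "\<kappa> powr - (l' * q' + 1) * \<kappa> powr (l' * q' + 1) = 1"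
        using pos by (simp add: powr_add[symmetric])
      ultimately show ?thesis by (simp add: powr_mult powr_powr b)
    qed
    finally show ?thesis using R by (simp add: mass)
  qed
  show ?thesis
    using morrey_spaceI[OF meas mass_pos assms(2) less_imp_le[OF N] le] N by blast
qed

text \<open>Tests an admissible constant on the critical powers. The factor \<open>a\<close> is
  quantified first: it depends on r, the dimension and the exponents, but not on
  \<open>\<Phi>\<close> or \<open>A\<close>.\<close>

lemma C1_le_hausdorff_bounds:
  assumes dim: "n = real CARD('n)"
  shows "\<exists>a>0. \<forall>(\<Phi> :: real^'n \<Rightarrow> complex) (A :: 'm \<Rightarrow> real^'n \<Rightarrow> real^'n^'n) K.
    admissible_kernel \<Phi> A \<and> rho A = ereal r \<and> real_of_constant_sign \<Phi> \<and>
    K \<in> hausdorff_bounds \<Phi> A (power_weight \<beta>) (power_weight \<gamma>) q l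
      (\<lambda>i. power_weight (\<beta>s i)) (\<lambda>i. power_weight (\<gamma>s i)) qs ls \<longrightarrow>
    C1 \<Phi> A \<beta>s \<gamma>s qs ls < \<infinity> \<and> a * enn2real (C1 \<Phi> A \<beta>s \<gamma>s qs ls) \<le> K"
proof -
  define f where "f i z = complex_of_real (norm z powr s i)" for i and z :: "real^'n"
  have qs0: "qs i > 0" for i using qs[of i] by simp
  have q0: "q > 0" using q by simp
  have dims: "- real DIM(real^'n) < \<beta>s i" "- real DIM(real^'n) < \<beta>" for i
    using \<beta>s[of i] \<beta> dim by auto
  have "\<exists>N>0. f i \<in> morrey_space (power_weight (\<beta>s i)) (power_weight (\<gamma>s i)) (qs i) (ls i) \<and>
      morrey_norm (power_weight (\<beta>s i)) (power_weight (\<gamma>s i)) (qs i) (ls i) (f i) \<le> N" for i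
    unfolding f_def using dims(1)[of i] qs0[of i] ls[of i]
    by (intro powr_in_morrey_space) (auto simp: s_def dim[symmetric])
  then obtain N where N: "\<And>i. N i > 0"
    and fN: "\<And>i. f i \<in> morrey_space (power_weight (\<beta>s i)) (power_weight (\<gamma>s i)) (qs i) (ls i)"
      "\<And>i. morrey_norm (power_weight (\<beta>s i)) (power_weight (\<gamma>s i)) (qs i) (ls i) (f i) \<le> N i"
    by metis
  define S where "S = (\<Sum>i\<in>UNIV. s i)"
  define b where "b = S * q + \<gamma>"
  have b: "b + n = (\<beta> + n) * (l * q + 1)"
    using q0 by (simp add: b_def S_def sum_s field_simps)
  have "(\<beta> + n) * (l * q + 1) > 0" using \<beta> l by (intro mult_pos_pos) auto
  then have bn: "b > - real DIM(real^'n)" using b dim by simp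
  define \<kappa> where "\<kappa> = weight_mass (power_weight \<beta>) (ball (0::real^'n) 1)"
  define \<mu> where "\<mu> = weight_mass (power_weight b) (ball (0::real^'n) 1)"
  have pos: "\<kappa> > 0" "\<mu> > 0"
    using weight_mass_power_weight_pos[OF dims(2)] weight_mass_power_weight_pos[OF bn] by (auto simp: \<kappa>_def \<mu>_def)
  have mass_pos: "weight_mass (power_weight \<beta>) (ball (0::real^'n) R) > 0" if "R > 0" for R
    using weight_mass_power_weight_ball[OF dims(2) that] pos that by (simp add: \<kappa>_def)
  have mass_pos': "weight_mass (power_weight (\<beta>s i)) (ball (0::real^'n) R) > 0" if "R > 0" for i R
    using weight_mass_power_weight_ball[OF dims(1) that] weight_mass_power_weight_pos[OF dims(1)] that by simp
  define L where "L = distortion (max 1 r)"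
  have L: "L > 0" unfolding L_def by (intro distortion_pos) simp
  define P where "P = (\<Prod>i\<in>UNIV. N i)"
  have P: "P > 0" unfolding P_def using N by (intro prod_pos) auto
  \<comment> \<open>Obtained by solving the final inequality for K: \<open>\<mu>\<close> is the mass
    of the critical power on the unit ball, \<open>L\<^sup>2\<close> the pointwise loss, P a bound
    for the norms of the test functions.\<close>
  define a where "a = \<mu> powr (1 / q) / (L\<^sup>2 * P * \<kappa> powr (l + 1 / q))"
  have "C1 \<Phi> A \<beta>s \<gamma>s qs ls < \<infinity> \<and> a * enn2real (C1 \<Phi> A \<beta>s \<gamma>s qs ls) \<le> K"
    if adm: "admissible_kernel \<Phi> A" and rho: "rho A = ereal r" and sign: "real_of_constant_sign \<Phi>"
      and K: "K \<in> hausdorff_bounds \<Phi> A (power_weight \<beta>) (power_weight \<gamma>) q l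
        (\<lambda>i. power_weight (\<beta>s i)) (\<lambda>i. power_weight (\<gamma>s i)) qs ls"
    for \<Phi> :: "real^'n \<Rightarrow> complex" and A :: "'m \<Rightarrow> real^'n \<Rightarrow> real^'n^'n" and K
  proof -
    define C where "C = enn2real (C1 \<Phi> A \<beta>s \<gamma>s qs ls)"
    define H where "H = hausdorff_op \<Phi> A f"
    define M where "M = morrey_norm (power_weight \<beta>) (power_weight \<gamma>) q l H"
    from K fN(1) have K0: "K \<ge> 0" and wd: "hausdorff_well_defined \<Phi> A f"
      and Y: "H \<in> morrey_space (power_weight \<beta>) (power_weight \<gamma>) q l"
      and MK: "M \<le> K * (\<Prod>i\<in>UNIV. morrey_norm (power_weight (\<beta>s i)) (power_weight (\<gamma>s i)) (qs i) (ls i) (f i))"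
      unfolding hausdorff_bounds_def multilinear_bounds_def M_def H_def by auto
    note HD = morrey_spaceD[OF Y mass_pos q0, folded M_def]
    have "(\<Prod>i\<in>UNIV. morrey_norm (power_weight (\<beta>s i)) (power_weight (\<gamma>s i)) (qs i) (ls i) (f i)) \<le> P"
      unfolding P_def using fN(2) morrey_spaceD(2)[OF fN(1) mass_pos' qs0] by (intro prod_mono) auto
    then have MP: "M \<le> K * P" using MK K0 by (meson mult_left_mono order_trans)
    have ae: "AE x in lborel. x \<noteq> 0 \<longrightarrow>
        C1 \<Phi> A \<beta>s \<gamma>s qs ls \<le> ennreal (L\<^sup>2 * norm x powr - S * norm (H x))"
      using wd[unfolded hausdorff_well_defined_def AE_completion_iff]
    proof eventually_elim
      fix x assume x: "integrable lebesgue (hausdorff_integrand \<Phi> A f x)"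
      show "x \<noteq> 0 \<longrightarrow> C1 \<Phi> A \<beta>s \<gamma>s qs ls \<le> ennreal (L\<^sup>2 * norm x powr - S * norm (H x))"
        using C1_le_hausdorff_power[OF dim adm rho sign, of x] x
        unfolding H_def S_def L_def f_def[abs_def] by auto
    qed
    have fin: "C1 \<Phi> A \<beta>s \<gamma>s qs ls < \<infinity>"
    proof -
      \<comment> \<open>\<open>C1\<close> does not depend on x, so a single point with a convergent
        integral settles finiteness; one exists because Lebesgue measure is not zero.\<close>
      have "AE x in lborel. (x::real^'n) \<noteq> 0 \<and> C1 \<Phi> A \<beta>s \<gamma>s qs ls < \<infinity>"
        using ae AE_lborel_singleton[of "0::real^'n"]
        by eventually_elim (auto simp: less_top[symmetric] top_unique)
      then have "AE x in (lborel :: (real^'n) measure). C1 \<Phi> A \<beta>s \<gamma>s qs ls < \<infinity>" by (rule eventually_mono) simp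
      then show ?thesis by (auto simp: eventually_const_iff ae_filter_eq_bot_iff)
    qed
    have ae': "AE x in lborel. x \<noteq> 0 \<longrightarrow> C / L\<^sup>2 * norm x powr S \<le> norm (H x)"
      using ae
    proof eventually_elim
      fix x :: "real^'n"
      assume x: "x \<noteq> 0 \<longrightarrow> C1 \<Phi> A \<beta>s \<gamma>s qs ls \<le> ennreal (L\<^sup>2 * norm x powr - S * norm (H x))"
      show "x \<noteq> 0 \<longrightarrow> C / L\<^sup>2 * norm x powr S \<le> norm (H x)"
      proof
        assume "x \<noteq> 0"
        with x have "C \<le> L\<^sup>2 * norm x powr - S * norm (H x)"
          unfolding C_def by (intro enn2real_leI) auto
        then show "C / L\<^sup>2 * norm x powr S \<le> norm (H x)"
          using L \<open>x \<noteq> 0\<close> by (simp add: powr_minus field_simps)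
      qed
    qed
    have C0: "C \<ge> 0" by (simp add: C_def)
    \<comment> \<open>The unit ball suffices: the lower bound for H is a multiple of a critical
      power, whose quotient is the same at every radius.\<close>
    have "ennreal ((C / L\<^sup>2) powr q * \<mu>) = ennreal ((C / L\<^sup>2) powr q) * (\<integral>\<^sup>+x\<in>ball (0::real^'n) 1. ennreal (norm x powr b) \<partial>lborel)"
      using ennreal_weight_mass_power_weight[OF bn, of 1] by (simp add: \<mu>_def ennreal_mult')
    also have "\<dots> = (\<integral>\<^sup>+x\<in>ball (0::real^'n) 1. ennreal ((C / L\<^sup>2) powr q * norm x powr b) \<partial>lborel)"
      by (subst nn_integral_cmult[symmetric]) (auto simp: ennreal_mult mult.assoc)
    also have "\<dots> \<le> (\<integral>\<^sup>+x\<in>ball 0 1. ennreal (norm (H x) powr q * norm x powr \<gamma>) \<partial>lborel)"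
    proof (rule nn_integral_mono_AE, use ae' AE_lborel_singleton[of "0::real^'n"] in eventually_elim)
      fix x :: "real^'n" assume x: "x \<noteq> 0 \<longrightarrow> C / L\<^sup>2 * norm x powr S \<le> norm (H x)" "x \<noteq> 0"
      then have "(C / L\<^sup>2 * norm x powr S) powr q \<le> norm (H x) powr q"
        using q0 C0 L by (intro powr_mono2) auto
      then have "(C / L\<^sup>2 * norm x powr S) powr q * norm x powr \<gamma> \<le> norm (H x) powr q * norm x powr \<gamma>"
        by (intro mult_right_mono) auto
      also have "(C / L\<^sup>2 * norm x powr S) powr q * norm x powr \<gamma> = (C / L\<^sup>2) powr q * norm x powr b"
        by (simp only: powr_mult powr_powr b_def powr_add mult.assoc)
      finally show "ennreal ((C / L\<^sup>2) powr q * norm x powr b) * indicator (ball 0 1) x \<le>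
          ennreal (norm (H x) powr q * norm x powr \<gamma>) * indicator (ball 0 1) x"
        by (intro mult_right_mono ennreal_leI) auto
    qed
    also have "\<dots> \<le> ennreal (M powr q * \<kappa> powr (l * q + 1))"
      using HD(5)[of 1] by (simp add: \<kappa>_def)
    finally have "(C / L\<^sup>2) powr q * \<mu> \<le> M powr q * \<kappa> powr (l * q + 1)"
      by simp
    then have "((C / L\<^sup>2) powr q * \<mu>) powr (1 / q) \<le> (M powr q * \<kappa> powr (l * q + 1)) powr (1 / q)"
      using q0 pos by (intro powr_mono2) auto
    then have "C / L\<^sup>2 * \<mu> powr (1 / q) \<le> M * \<kappa> powr ((l * q + 1) * (1 / q))"
      using q0 C0 HD(2) L by (simp add: powr_mult powr_powr)
    also have "(l * q + 1) * (1 / q) = l + 1 / q" using q0 by (simp add: field_simps)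
    also have "M * \<kappa> powr (l + 1 / q) \<le> K * P * \<kappa> powr (l + 1 / q)"
      using MP by (intro mult_right_mono) auto
    finally have "a * C \<le> K"
      using L P pos by (simp add: a_def field_simps)
    then show ?thesis using fin by (simp add: C_def)
  qed
  moreover have "a > 0" using L P pos by (simp add: a_def)
  ultimately show ?thesis by blast
qed

end

theorem theorem3p1:
  fixes \<beta> \<gamma> q l \<rho> :: real
    and \<beta>s \<gamma>s qs ls :: "'m::finite \<Rightarrow> real"
    and v w :: "real^'n \<Rightarrow> real"
    and vs ws :: "'m \<Rightarrow> real^'n \<Rightarrow> real"
  defines "v \<equiv> power_weight \<beta>" and "w \<equiv> power_weight \<gamma>"
    and "vs \<equiv> \<lambda>i. power_weight (\<beta>s i)" and "ws \<equiv> \<lambda>i. power_weight (\<gamma>s i)"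
  assumes "\<beta> > - real CARD('n)" and "\<gamma> > - real CARD('n)"
    and "\<And>i. \<beta>s i > - real CARD('n)" and "\<And>i. \<gamma>s i > - real CARD('n)"
    and "1 \<le> q" and "\<And>i. 1 \<le> qs i" and "(\<Sum>i\<in>UNIV. 1 / qs i) = 1 / q"
    and "1 + l * q > 0" and "\<And>i. 1 + ls i * qs i > 0"
    and "(\<Sum>i\<in>UNIV. \<beta>s i / qs i) = \<beta> / q"
    and "(\<Sum>i\<in>UNIV. (real CARD('n) + \<beta>s i) / (real CARD('n) + \<beta>) * ls i) = l"
    and "(\<Sum>i\<in>UNIV. \<gamma>s i / qs i) = \<gamma> / q"
  shows
    "(\<exists>C>0. \<forall>(\<Phi> :: real^'n \<Rightarrow> complex) (A :: 'm \<Rightarrow> real^'n \<Rightarrow> real^'n^'n).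
        admissible_kernel \<Phi> A \<and> rho A = ereal \<rho> \<and> C1 \<Phi> A \<beta>s \<gamma>s qs ls < \<infinity> \<longrightarrow>
          hausdorff_bounded \<Phi> A v w q l vs ws qs ls \<and>
          hausdorff_norm \<Phi> A v w q l vs ws qs ls \<le> C * enn2real (C1 \<Phi> A \<beta>s \<gamma>s qs ls)) \<and>
     (\<exists>c>0. \<forall>(\<Phi> :: real^'n \<Rightarrow> complex) (A :: 'm \<Rightarrow> real^'n \<Rightarrow> real^'n^'n).
        admissible_kernel \<Phi> A \<and> rho A = ereal \<rho> \<and> real_of_constant_sign \<Phi> \<and>
        hausdorff_bounded \<Phi> A v w q l vs ws qs ls \<longrightarrow>
          C1 \<Phi> A \<beta>s \<gamma>s qs ls < \<infinity> \<and>
          c * enn2real (C1 \<Phi> A \<beta>s \<gamma>s qs ls) \<le> hausdorff_norm \<Phi> A v w q l vs ws qs ls)"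
proof -
  interpret morrey_exponents "real CARD('n)" \<beta> \<gamma> q l \<beta>s \<gamma>s qs ls
    by unfold_locales (use assms in auto)
  define \<kappa> where "\<kappa> i = weight_mass (power_weight (\<beta>s i)) (ball (0::real^'n) 1)" for i
  define \<kappa>0 where "\<kappa>0 = weight_mass (power_weight \<beta>) (ball (0::real^'n) 1)"
  \<comment> \<open>Built from \<open>\<rho>\<close>, the dimension and the exponents only, before
    any kernel or matrix family is fixed.\<close>
  define K where "K = distortion (max 1 \<rho>) * (\<Prod>i\<in>UNIV. c (max 1 \<rho>) \<kappa> i) * \<kappa>0 powr - (l + 1 / q)"
  have \<kappa>: "\<kappa> i > 0" "\<kappa>0 > 0" for i
    using weight_mass_power_weight_pos[where 'a="real^'n"] \<beta> \<beta>s[of i] by (auto simp: \<kappa>_def \<kappa>0_def)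
  have "c (max 1 \<rho>) \<kappa> i > 0" for i
    using \<kappa>(1)[of i] by (simp add: c_def)
  then have K: "K > 0"
    unfolding K_def using \<kappa>(2) by (intro mult_pos_pos prod_pos distortion_pos) auto
  have bdd: "bdd_below (hausdorff_bounds \<Phi> A v w q l vs ws qs ls)"
    for \<Phi> :: "real^'n \<Rightarrow> complex" and A :: "'m \<Rightarrow> real^'n \<Rightarrow> real^'n^'n"
    by (intro bdd_belowI[of _ 0]) (simp add: hausdorff_bounds_def multilinear_bounds_def)
  have upper: "hausdorff_bounded \<Phi> A v w q l vs ws qs ls \<and>
      hausdorff_norm \<Phi> A v w q l vs ws qs ls \<le> K * enn2real (C1 \<Phi> A \<beta>s \<gamma>s qs ls)"
    if "admissible_kernel \<Phi> A" "rho A = ereal \<rho>" "C1 \<Phi> A \<beta>s \<gamma>s qs ls < \<infinity>"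
    for \<Phi> :: "real^'n \<Rightarrow> complex" and A :: "'m \<Rightarrow> real^'n \<Rightarrow> real^'n^'n"
  proof -
    have "K * enn2real (C1 \<Phi> A \<beta>s \<gamma>s qs ls) \<in> hausdorff_bounds \<Phi> A v w q l vs ws qs ls"
      unfolding hausdorff_bounds_def multilinear_bounds_def v_def w_def vs_def ws_def
    proof (intro CollectI conjI allI impI)
      show "0 \<le> K * enn2real (C1 \<Phi> A \<beta>s \<gamma>s qs ls)" using K by simp
    next
      fix f :: "'m \<Rightarrow> real^'n \<Rightarrow> complex"
      assume "\<forall>i. f i \<in> morrey_space (power_weight (\<beta>s i)) (power_weight (\<gamma>s i)) (qs i) (ls i)"
      then have f: "\<And>i. f i \<in> morrey_space (power_weight (\<beta>s i)) (power_weight (\<gamma>s i)) (qs i) (ls i)" by blast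
      note bound = hausdorff_op_bound[OF refl that f, folded \<kappa>0_def, folded \<kappa>_def[abs_def], folded K_def]
      show "hausdorff_well_defined \<Phi> A f"
        "hausdorff_op \<Phi> A f \<in> morrey_space (power_weight \<beta>) (power_weight \<gamma>) q l"
        "morrey_norm (power_weight \<beta>) (power_weight \<gamma>) q l (hausdorff_op \<Phi> A f) \<le>
          K * enn2real (C1 \<Phi> A \<beta>s \<gamma>s qs ls) *
          (\<Prod>i\<in>UNIV. morrey_norm (power_weight (\<beta>s i)) (power_weight (\<gamma>s i)) (qs i) (ls i) (f i))"
        by (rule bound)+
    qed
    then show ?thesis
      using cInf_lower[OF _ bdd] by (auto simp: hausdorff_bounded_def hausdorff_norm_def)
  qed
  obtain a where a: "a > 0"
    and lower: "\<And>(\<Phi> :: real^'n \<Rightarrow> complex) (A :: 'm \<Rightarrow> real^'n \<Rightarrow> real^'n^'n) K.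
      admissible_kernel \<Phi> A \<Longrightarrow> rho A = ereal \<rho> \<Longrightarrow> real_of_constant_sign \<Phi> \<Longrightarrow>
      K \<in> hausdorff_bounds \<Phi> A v w q l vs ws qs ls \<Longrightarrow>
      C1 \<Phi> A \<beta>s \<gamma>s qs ls < \<infinity> \<and> a * enn2real (C1 \<Phi> A \<beta>s \<gamma>s qs ls) \<le> K"
    using C1_le_hausdorff_bounds[where 'n='n and r=\<rho>] unfolding v_def w_def vs_def ws_def by blast
  \<comment> \<open>Every admissible constant dominates the same multiple of \<open>C1\<close>,
    hence so does their infimum; boundedness supplies the nonempty set on which the infimum is
    meaningful.\<close>
  have lower': "C1 \<Phi> A \<beta>s \<gamma>s qs ls < \<infinity> \<and>
      a * enn2real (C1 \<Phi> A \<beta>s \<gamma>s qs ls) \<le> hausdorff_norm \<Phi> A v w q l vs ws qs ls"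
    if "admissible_kernel \<Phi> A" "rho A = ereal \<rho>" "real_of_constant_sign \<Phi>"
      "hausdorff_bounded \<Phi> A v w q l vs ws qs ls"
    for \<Phi> :: "real^'n \<Rightarrow> complex" and A :: "'m \<Rightarrow> real^'n \<Rightarrow> real^'n^'n"
    using that lower[OF that(1-3)] unfolding hausdorff_bounded_def hausdorff_norm_def
    by (auto intro!: cInf_greatest)
  show ?thesis using K a upper lower' by blast
qed

end
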